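(* The extended frame for the translationally equivariant minimal Lagrangian surface in $\mathbb{C}P^2$ generated by the potential $D(\lambda)dz$, where $$D(\lambda)=\begin{pmatrix}0&-\lambda\bar b&\lambda^{-1}a\\ \lambda^{-1}b&0&-\lambda\bar a\\ -\lambda\bar a&\lambda^{-1}a&0\end{pmatrix},\qquad ab\neq0,$$ is given by $$\mathbb{F}(z,\lambda)=\exp\big(zD-\beta_1(y,\lambda)D-\beta_2(y,\lambda)L_0\big)\,Q^{-1}(y,\lambda),$$ where $L_0=D^2-\frac13\mathrm{tr}(D^2)I$, $$\beta_1(y,\lambda)=\int_0^y\frac{2i\lambda^3\bar\psi-iu'e^u}{\lambda^3\bar\psi-\lambda^{-3}\psi-e^uu'}ds,\qquad \beta_2(y,\lambda)=\int_0^y\frac{2e^u}{\lambda^3\bar\psi-\lambda^{-3}\psi-e^uu'}ds,$$ and $Q=Q_0\tilde Q$ with $Q_0=\mathrm{diag}(ia^{-1}e^{u/2},-iae^{-u/2},1)$ and $$\tilde Q=\frac{\lambda^3}{\kappa}\begin{pmatrix}\check p&\check q&\check v_1\\ \check s&\check t&\check v_2\\ 0&0&\check c\end{pmatrix},$$ $\check p=-|a|^2\frac{u'}{2}+\lambda^3\bar\psi|a|^2e^{-u}-\lambda^{-3}\psi$, $\check q=\frac{\lambda^{-2}a}{\bar a}\left[\frac{u'}{2}|a|^2-\lambda^3\bar\psi e^{-u}(|a|^2-e^u)\right]$, $\check s=\frac{\lambda^2}{a^2}\left[|a|^2\frac{u'}{2}e^u+\lambda^{-3}\psi(|a|^2-e^u)\right]$,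 $\check t=\frac{1}{|a|^2}\left(-|a|^2\frac{u'}{2}e^u+\lambda^3\bar\psi e^u-\lambda^{-3}\psi|a|^2\right)$, $\check v_1=-2i\lambda^{-1}a(|a|^2-e^u)$, $\check v_2=-2i\lambda a^{-1}e^u(|a|^2-e^u)$, $\check c=\lambda^3\bar\psi-\lambda^{-3}\psi-e^uu'$, $\kappa=(\lambda^6\bar\psi-\psi-\lambda^3e^uu')^{2/3}(\lambda^6\bar\psi-\psi)^{1/3}$, and $u=u(y)$ given by $e^{u(y)}=a_1(1-q^2\mathrm{sn}^2(ry,k))$.
   Context: $z=x+iy$, $'=d/dy$. The surface is not totally geodesic and not flat, and the origin is chosen so that $u'(0)=0$ and $u(0)=\max u$. Here $a=ie^{u(0)/2}$, $b=i\psi/a^2$ are constants, $\psi=-ia^2b\ne0$ is the constant occurring in the cubic form. Put $a_1=e^{u(0)}=|a|^2$, $\beta=2|a|^2+|b|^2=2a_1+|\psi|^2/a_1^2$, $c=\frac\beta2-a_1$, $a_2=\frac{c+\sqrt{c^2+4a_1c}}2$, $a_3=\frac{-c+\sqrt{c^2+4a_1c}}2$, with $a_1>a_2$; $k^2=\frac{a_1-a_2}{a_1+a_3}$, $q^2=\frac{a_1-a_2}{a_1}$, $r=\sqrt{2(a_1+a_3)}$; $\mathrm{sn}(\cdot,k)$ is the Jacobi elliptic function of modulus $k$. Loop groups: $\epsilon=e^{\pi i/3}$, $\alpha=e^{2\pi i/3}$, $P=\begin{pmatrix}0&\alpha&0\\ \alpha^2&0&0\\ 0&0&1\end{pmatrix}$,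 $\sigma(g)=P(g^t)^{-1}P^{-1}$; $\Lambda SU(3)_\sigma$ and $\Lambda SL(3,\mathbb{C})_\sigma$ are the loops $g$ on $S^1$ in $SU(3)$, $SL(3,\mathbb{C})$ with $g(\epsilon\lambda)=\sigma(g(\lambda))$, and $\Lambda^+SL(3,\mathbb{C})_\sigma$ consists of those extending holomorphically to $|\lambda|<1$. The surface generated by $D(\lambda)dz$ is $[\mathbb{F}(z,\lambda)e_3]$, where $\exp(zD(\lambda))=\mathbb{F}(z,\lambda)U_+(y,\lambda)$ is an Iwasawa splitting with $\mathbb{F}\in\Lambda SU(3)_\sigma$, $U_+\in\Lambda^+SL(3,\mathbb{C})_\sigma$; the extended frame $\mathbb{F}$ is the one normalized by $\mathbb{F}(0,\lambda)=I$ and $$\mathbb{F}^{-1}\mathbb{F}_z=\lambda^{-1}\begin{pmatrix}0&0&ie^{u/2}\\ -i\psi e^{-u}&0&0\\ 0&ie^{u/2}&0\end{pmatrix}+\mathrm{diag}\left(\tfrac{u_z}{2},-\tfrac{u_z}{2},0\right),\quad \mathbb{F}^{-1}\mathbb{F}_{\bar z}=\lambda\begin{pmatrix}0&-i\bar\psi e^{-u}&0\\ 0&0&ie^{u/2}\\ ie^{u/2}&0&0\end{pmatrix}+\mathrm{diag}\left(-\tfrac{u_{\bar z}}{2},\tfrac{u_{\bar z}}{2},0\right).$$ $\mathbb{F}$ and $U_+$ are defined for all $\lambda\in\mathbb{C}^*$, $z\in\mathbb{C}$. The individual terms on the right hand side are only defined for small $\lambda\neq0$ and a restricted set of $y$ (where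 the denominators do not vanish along the path from $0$ to $y$), and the formula is understood there; the branch of $\kappa$ is the one continuous in $y$ with $\kappa=\lambda^6\bar\psi-\psi$ at $y=0$, so that $Q(0,\lambda)=I$. *)

theory Defs
  imports "HOL-Analysis.Analysis"
begin

type_synonym cmat3 = "complex ^ 3 ^ 3"

section \<open>Complex 3 by 3 matrices\<close>

definition mat_scale :: "complex \<Rightarrow> cmat3 \<Rightarrow> cmat3"  (infixr "*\<^sub>m" 75)
  where "c *\<^sub>m A = map_matrix (\<lambda>x. c * x) A"

definition diag3 :: "complex \<Rightarrow> complex \<Rightarrow> complex \<Rightarrow> cmat3"
  where "diag3 x y z = vector [vector [x, 0, 0], vector [0, y, 0], vector [0, 0, z]]"

definition mat_power :: "cmat3 \<Rightarrow> nat \<Rightarrow> cmat3"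
  where "mat_power A n = (((**) A) ^^ n) (mat 1)"

text \<open>The library function \<open>exp\<close> is not available here, since \<open>cmat3\<close> is not
  an instance of the class of real normed algebras.\<close>

definition mat_exp :: "cmat3 \<Rightarrow> cmat3"
  where "mat_exp A = (\<Sum>n. (1 / fact n) *\<^sub>R mat_power A n)"

definition SL3 :: "cmat3 set"
  where "SL3 = {g. det g = 1}"

definition SU3 :: "cmat3 set"
  where "SU3 = {g. g ** transpose (map_matrix cnj g) = mat 1 \<and> det g = 1}"


section \<open>Twisted loop groups\<close>

text \<open>A loop is a continuous map on the unit circle. It is represented by a function on
  all of the complex plane, of which only the values on the unit circle are used.
  The loop parameter is written \<open>\<nu>\<close>, since lambda is reserved for abstraction.\<close>

definition twist_eps :: complex
  where "twist_eps = exp (\<i> * of_real pi / 3)"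

definition twist_alpha :: complex
  where "twist_alpha = exp (2 * \<i> * of_real pi / 3)"

definition twist_P :: cmat3
  where "twist_P =
    vector [vector [0, twist_alpha, 0], vector [twist_alpha ^ 2, 0, 0], vector [0, 0, 1]]"

definition twist_sigma :: "cmat3 \<Rightarrow> cmat3"
  where "twist_sigma g = twist_P ** matrix_inv (transpose g) ** matrix_inv twist_P"

definition twisted_loops :: "cmat3 set \<Rightarrow> (complex \<Rightarrow> cmat3) set"
  where "twisted_loops G =
    {g. continuous_on (sphere 0 1) g \<and>
        (\<forall>\<nu>\<in>sphere 0 1. g \<nu> \<in> G \<and> g (twist_eps * \<nu>) = twist_sigma (g \<nu>))}"

definition Loop_SU3 :: "(complex \<Rightarrow> cmat3) set"
  where "Loop_SU3 = twisted_loops SU3"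

definition Loop_SL3 :: "(complex \<Rightarrow> cmat3) set"
  where "Loop_SL3 = twisted_loops SL3"

definition Loop_plus_SL3 :: "(complex \<Rightarrow> cmat3) set"
  where "Loop_plus_SL3 =
    {g \<in> Loop_SL3. \<exists>h. continuous_on (cball 0 1) h \<and>
        (\<forall>i j. (\<lambda>\<nu>. h \<nu> $ i $ j) holomorphic_on ball 0 1) \<and>
        (\<forall>\<nu>\<in>sphere 0 1. h \<nu> = g \<nu>)}"


section \<open>Extended frames\<close>

text \<open>Wirtinger derivatives.\<close>

definition d_z :: "(complex \<Rightarrow> complex) \<Rightarrow> complex \<Rightarrow> complex"
  where "d_z f z = (frechet_derivative f (at z) 1 - \<i> * frechet_derivative f (at z) \<i>) / 2"

definition d_zbar :: "(complex \<Rightarrow> complex) \<Rightarrow> complex \<Rightarrow> complex"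
  where "d_zbar f z = (frechet_derivative f (at z) 1 + \<i> * frechet_derivative f (at z) \<i>) / 2"

definition mat_d_z :: "(complex \<Rightarrow> cmat3) \<Rightarrow> complex \<Rightarrow> cmat3"
  where "mat_d_z F z = (\<chi> i j. d_z (\<lambda>w. F w $ i $ j) z)"

definition mat_d_zbar :: "(complex \<Rightarrow> cmat3) \<Rightarrow> complex \<Rightarrow> cmat3"
  where "mat_d_zbar F z = (\<chi> i j. d_zbar (\<lambda>w. F w $ i $ j) z)"

text \<open>The metric function \<open>u\<close> of a translationally equivariant surface depends on
  \<open>y = Im z\<close> only; \<open>lift u\<close> is the corresponding function of \<open>z\<close>.\<close>

definition lift :: "(real \<Rightarrow> real) \<Rightarrow> complex \<Rightarrow> complex"
  where "lift u z = of_real (u (Im z))"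

definition frame_U :: "complex \<Rightarrow> (real \<Rightarrow> real) \<Rightarrow> complex \<Rightarrow> complex \<Rightarrow> cmat3"
  where "frame_U \<psi> u z \<nu> =
    (1 / \<nu>) *\<^sub>m vector
      [vector [0, 0, \<i> * exp (lift u z / 2)],
       vector [- \<i> * \<psi> * exp (- lift u z), 0, 0],
       vector [0, \<i> * exp (lift u z / 2), 0]]
    + diag3 (d_z (lift u) z / 2) (- d_z (lift u) z / 2) 0"

definition frame_V :: "complex \<Rightarrow> (real \<Rightarrow> real) \<Rightarrow> complex \<Rightarrow> complex \<Rightarrow> cmat3"
  where "frame_V \<psi> u z \<nu> =
    \<nu> *\<^sub>m vector
      [vector [0, - \<i> * cnj \<psi> * exp (- lift u z), 0],
       vector [0, 0, \<i> * exp (lift u z / 2)],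
       vector [\<i> * exp (lift u z / 2), 0, 0]]
    + diag3 (- d_zbar (lift u) z / 2) (d_zbar (lift u) z / 2) 0"

definition extended_frame ::
    "complex \<Rightarrow> (real \<Rightarrow> real) \<Rightarrow> (complex \<Rightarrow> complex \<Rightarrow> cmat3) \<Rightarrow> bool"
  where "extended_frame \<psi> u F \<longleftrightarrow>
    (\<forall>y. u differentiable (at y)) \<and>
    (\<forall>\<nu>. \<nu> \<noteq> 0 \<longrightarrow>
       F 0 \<nu> = mat 1 \<and>
       (\<forall>z. (\<lambda>w. F w \<nu>) differentiable (at z) \<and> invertible (F z \<nu>) \<and>
            matrix_inv (F z \<nu>) ** mat_d_z (\<lambda>w. F w \<nu>) z = frame_U \<psi> u z \<nu> \<and>
            matrix_inv (F z \<nu>) ** mat_d_zbar (\<lambda>w. F w \<nu>) z = frame_V \<psi> u z \<nu>))"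

definition potential :: "complex \<Rightarrow> complex \<Rightarrow> complex \<Rightarrow> cmat3"
  where "potential a b \<nu> = vector
    [vector [0, - \<nu> * cnj b, a / \<nu>],
     vector [b / \<nu>, 0, - \<nu> * cnj a],
     vector [- \<nu> * cnj a, a / \<nu>, 0]]"

text \<open>Iwasawa splitting of \<open>exp (z D)\<close>. The second factor depends on \<open>z\<close> only through
  \<open>y = Im z\<close>; this is the translational equivariance.\<close>

definition iwasawa_splitting ::
    "(complex \<Rightarrow> cmat3) \<Rightarrow> (complex \<Rightarrow> complex \<Rightarrow> cmat3) \<Rightarrow>
     (real \<Rightarrow> complex \<Rightarrow> cmat3) \<Rightarrow> bool"
  where "iwasawa_splitting D F Up \<longleftrightarrow>
    (\<forall>z \<nu>. \<nu> \<noteq> 0 \<longrightarrow> mat_exp (z *\<^sub>m D \<nu>) = F z \<nu> ** Up (Im z) \<nu>) \<and>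
    (\<forall>z. F z \<in> Loop_SU3) \<and> (\<forall>y. Up y \<in> Loop_plus_SL3)"


section \<open>The metric\<close>

text \<open>Incomplete elliptic integral of the first kind, Jacobi amplitude and Jacobi \<open>sn\<close>,
  each for a modulus \<open>k\<close> with \<open>0 \<le> k < 1\<close>.\<close>

definition elliptic_F :: "real \<Rightarrow> real \<Rightarrow> real"
  where "elliptic_F \<phi> k = (LBINT \<theta>=0..ereal \<phi>. 1 / sqrt (1 - k\<^sup>2 * (sin \<theta>)\<^sup>2))"

definition jacobi_am :: "real \<Rightarrow> real \<Rightarrow> real"
  where "jacobi_am x k = (THE \<phi>. elliptic_F \<phi> k = x)"

definition jacobi_sn :: "real \<Rightarrow> real \<Rightarrow> real"
  where "jacobi_sn x k = sin (jacobi_am x k)"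

definition par_a1 :: "complex \<Rightarrow> real"
  where "par_a1 a = (cmod a)\<^sup>2"

definition par_beta :: "complex \<Rightarrow> complex \<Rightarrow> real"
  where "par_beta a b = 2 * (cmod a)\<^sup>2 + (cmod b)\<^sup>2"

definition par_c :: "complex \<Rightarrow> complex \<Rightarrow> real"
  where "par_c a b = par_beta a b / 2 - par_a1 a"

definition par_a2 :: "complex \<Rightarrow> complex \<Rightarrow> real"
  where "par_a2 a b = (par_c a b + sqrt ((par_c a b)\<^sup>2 + 4 * par_a1 a * par_c a b)) / 2"

definition par_a3 :: "complex \<Rightarrow> complex \<Rightarrow> real"
  where "par_a3 a b = (- par_c a b + sqrt ((par_c a b)\<^sup>2 + 4 * par_a1 a * par_c a b)) / 2"

definition par_k :: "complex \<Rightarrow> complex \<Rightarrow> real"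
  where "par_k a b = sqrt ((par_a1 a - par_a2 a b) / (par_a1 a + par_a3 a b))"

definition par_q :: "complex \<Rightarrow> complex \<Rightarrow> real"
  where "par_q a b = sqrt ((par_a1 a - par_a2 a b) / par_a1 a)"

definition par_r :: "complex \<Rightarrow> complex \<Rightarrow> real"
  where "par_r a b = sqrt (2 * (par_a1 a + par_a3 a b))"


section \<open>The explicit Iwasawa factors\<close>

text \<open>\<open>eu u y\<close> and \<open>du u y\<close> are the complex numbers \<open>e\<^sup>u\<close> and \<open>u'\<close> at \<open>y\<close>.\<close>

definition eu :: "(real \<Rightarrow> real) \<Rightarrow> real \<Rightarrow> complex"
  where "eu u y = of_real (exp (u y))"

definition du :: "(real \<Rightarrow> real) \<Rightarrow> real \<Rightarrow> complex"
  where "du u y = of_real (deriv u y)"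

text \<open>The common denominator of the two integrands, which is also the lower right entry
  \<open>c\<close> of \<open>Q_tilde\<close>.\<close>

definition c_check :: "complex \<Rightarrow> (real \<Rightarrow> real) \<Rightarrow> real \<Rightarrow> complex \<Rightarrow> complex"
  where "c_check \<psi> u y \<nu> = \<nu>^3 * cnj \<psi> - \<psi> / \<nu>^3 - eu u y * du u y"

definition beta1 :: "complex \<Rightarrow> (real \<Rightarrow> real) \<Rightarrow> real \<Rightarrow> complex \<Rightarrow> complex"
  where "beta1 \<psi> u y \<nu> =
    (LBINT s=0..ereal y. (2 * \<i> * \<nu>^3 * cnj \<psi> - \<i> * du u s * eu u s) / c_check \<psi> u s \<nu>)"

definition beta2 :: "complex \<Rightarrow> (real \<Rightarrow> real) \<Rightarrow> real \<Rightarrow> complex \<Rightarrow> complex"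
  where "beta2 \<psi> u y \<nu> = (LBINT s=0..ereal y. 2 * eu u s / c_check \<psi> u s \<nu>)"

definition L0 :: "cmat3 \<Rightarrow> cmat3"
  where "L0 D = D ** D - (trace (D ** D) / 3) *\<^sub>m mat 1"

text \<open>The branch of
  \<open>(\<nu>\<^sup>6 cnj \<psi> - \<psi> - \<nu>\<^sup>3 e\<^sup>u u')\<close> to the power \<open>2/3\<close> times \<open>(\<nu>\<^sup>6 cnj \<psi> - \<psi>)\<close> to the power \<open>1/3\<close>
  obtained by continuation along the segment from \<open>0\<close> to \<open>y\<close>, starting with the value
  \<open>\<nu>\<^sup>6 cnj \<psi> - \<psi>\<close>. It is well defined if \<open>c_check\<close> has no zero on this segment.\<close>

definition kappa_branch ::
    "complex \<Rightarrow> (real \<Rightarrow> real) \<Rightarrow> real \<Rightarrow> complex \<Rightarrow> (real \<Rightarrow> complex) \<Rightarrow> bool"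
  where "kappa_branch \<psi> u y \<nu> \<kappa> \<longleftrightarrow>
    continuous_on (closed_segment 0 y) \<kappa> \<and>
    \<kappa> 0 = \<nu>^6 * cnj \<psi> - \<psi> \<and>
    (\<forall>s\<in>closed_segment 0 y.
       \<kappa> s ^ 3 = (\<nu>^6 * cnj \<psi> - \<psi> - \<nu>^3 * eu u s * du u s)^2 * (\<nu>^6 * cnj \<psi> - \<psi>))"

definition kappa :: "complex \<Rightarrow> (real \<Rightarrow> real) \<Rightarrow> real \<Rightarrow> complex \<Rightarrow> complex"
  where "kappa \<psi> u y \<nu> = (THE w. \<exists>\<kappa>. kappa_branch \<psi> u y \<nu> \<kappa> \<and> \<kappa> y = w)"

definition Q_zero :: "complex \<Rightarrow> (real \<Rightarrow> real) \<Rightarrow> real \<Rightarrow> cmat3"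
  where "Q_zero a u y =
    diag3 (\<i> / a * of_real (exp (u y / 2))) (- \<i> * a * of_real (exp (- u y / 2))) 1"

definition Q_tilde ::
    "complex \<Rightarrow> complex \<Rightarrow> (real \<Rightarrow> real) \<Rightarrow> real \<Rightarrow> complex \<Rightarrow> cmat3"
  where "Q_tilde a \<psi> u y \<nu> =
    (let A = of_real ((cmod a)\<^sup>2); E = eu u y; u' = du u y;
         p = - A * (u' / 2) + \<nu>^3 * cnj \<psi> * A / E - \<psi> / \<nu>^3;
         q = (a / (\<nu>^2 * cnj a)) * (u' / 2 * A - \<nu>^3 * cnj \<psi> / E * (A - E));
         s = (\<nu>^2 / a^2) * (A * (u' / 2) * E + \<psi> / \<nu>^3 * (A - E));
         t = (1 / A) * (- A * (u' / 2) * E + \<nu>^3 * cnj \<psi> * E - \<psi> / \<nu>^3 * A);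
         v1 = - 2 * \<i> * (a / \<nu>) * (A - E);
         v2 = - 2 * \<i> * (\<nu> / a) * E * (A - E);
         c = c_check \<psi> u y \<nu>
     in (\<nu>^3 / kappa \<psi> u y \<nu>) *\<^sub>m
          vector [vector [p, q, v1], vector [s, t, v2], vector [0, 0, c]])"

definition Q_mat ::
    "complex \<Rightarrow> complex \<Rightarrow> (real \<Rightarrow> real) \<Rightarrow> real \<Rightarrow> complex \<Rightarrow> cmat3"
  where "Q_mat a \<psi> u y \<nu> = Q_zero a u y ** Q_tilde a \<psi> u y \<nu>"

end

theory Submission
  imports Defs
begin

text \<open>
  Let \<open>A\<close> and \<open>B\<close> be the \<open>dx\<close> and \<open>dy\<close> components of \<open>F\<^sup>-\<^sup>1 dF\<close>; both depend on \<open>y\<close> only.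
  The factor \<open>U\<^sub>+\<close> of the splitting \<open>exp (z D) = F U\<^sub>+\<close> depends on \<open>y\<close> only as well, and this forces
  \<open>F (x + i y) = exp (x D) F (i y)\<close>. With \<open>G y = F (i y)\<close> one therefore has
  \<open>G' = G B\<close> and \<open>D G = G A\<close> (\<open>frame_has_vector_derivative_y\<close>, \<open>frame_intertwines\<close>).
  Everything else follows from these two equations.

  For the metric, let \<open>\<nu> = 1\<close>. There \<open>G\<close> is unitary, so \<open>A = G\<^sup>* D G\<close> is differentiable, and its
  first diagonal entry \<open>- i u' / 2\<close> yields \<open>u'' = 4 (|\<psi>|\<^sup>2 exp (-2 u) - exp u)\<close>, a fact that includes
  the existence of the second derivative (\<open>metric_second_derivative\<close>). Its first integral
  \<open>u'\<^sup>2 = 4 (\<beta> - 2 exp u - |\<psi>|\<^sup>2 exp (-2 u))\<close> turns it into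
  \<open>w'' = 4 \<beta> w - 12 w\<^sup>2\<close> for \<open>w = exp u\<close>. The elliptic expression solves the same equation with the
  same initial values, and bounded solutions are unique (\<open>metric_explicit\<close>).

  For the frame one looks for \<open>Q\<close> and for \<open>M\<close> in the span of \<open>D\<close> and \<open>L\<^sub>0\<close> with \<open>G Q = exp M\<close>.
  The relation \<open>D G = G A\<close> carries polynomials in \<open>D\<close> over to polynomials in \<open>A\<close>, so that
  \<open>exp (- M) G Q\<close> is constant as soon as
  \<open>Q' = ((i - \<beta>\<^sub>1') A - \<beta>\<^sub>2' (A\<^sup>2 + 2 \<beta> / 3) - B) Q\<close>,
  an equation from which the frame has disappeared. Multiplied by the common denominator of
  \<open>\<beta>\<^sub>1'\<close> and \<open>\<beta>\<^sub>2'\<close>, and with \<open>\<beta>\<close> eliminated by the first integral, it becomes an identity between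
  rational functions of \<open>exp (u / 2)\<close>, \<open>u'\<close> and \<open>\<nu>\<close> (\<open>Q_num_deriv_eq\<close>, \<open>Q_generator_eq_connection\<close>). The
  normalisation by \<open>\<kappa>\<close> absorbs the part of the equation that is a multiple of the identity
  (\<open>kappa_has_vector_derivative\<close>).
\<close>

section \<open>Matrix calculus\<close>

lemma mat_scale_nth [simp]: "(c *\<^sub>m A) $ i $ j = c * A $ i $ j"
  by (simp add: mat_scale_def map_matrix_def)

lemma scaleR_mat_nth [simp]: "((r::real) *\<^sub>R (A::cmat3)) $ i $ j = of_real r * A $ i $ j"
  unfolding vector_scaleR_component by (simp add: scaleR_conv_of_real)

lemma mat_scale_algebra:
  fixes A B :: cmat3
  shows "(c *\<^sub>m A) ** B = c *\<^sub>m (A ** B)" "A ** (c *\<^sub>m B) = c *\<^sub>m (A ** B)"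
    "c *\<^sub>m (A + B) = c *\<^sub>m A + c *\<^sub>m B" "(c + d) *\<^sub>m A = c *\<^sub>m A + d *\<^sub>m A"
    "(c - d) *\<^sub>m A = c *\<^sub>m A - d *\<^sub>m A" "c *\<^sub>m (A - B) = c *\<^sub>m A - c *\<^sub>m B"
    "c *\<^sub>m d *\<^sub>m A = (c * d) *\<^sub>m A" "1 *\<^sub>m A = A" "0 *\<^sub>m A = 0" "(- c) *\<^sub>m A = - (c *\<^sub>m A)"
    "c *\<^sub>m (- A) = - (c *\<^sub>m A)"
    "c *\<^sub>m 0 = 0"
  by (simp_all add: vec_eq_iff matrix_matrix_mult_def sum_3 algebra_simps)

lemma matrix_mult_add:
  fixes A B C :: cmat3
  shows "(A + B) ** C = A ** C + B ** C" "A ** (B + C) = A ** B + A ** C"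
    "(A - B) ** C = A ** C - B ** C" "A ** (B - C) = A ** B - A ** C"
  by (simp_all add: vec_eq_iff matrix_matrix_mult_def sum_3 algebra_simps)

lemma matrix_mult_minus:
  fixes A B :: cmat3
  shows "(- A) ** B = - (A ** B)" "A ** (- B) = - (A ** B)"
  by (simp_all add: vec_eq_iff matrix_matrix_mult_def sum_3)

lemma bounded_bilinear_matrix_mult: "bounded_bilinear ((**) :: cmat3 \<Rightarrow> cmat3 \<Rightarrow> cmat3)"
proof -
  have "bilinear ((**) :: cmat3 \<Rightarrow> cmat3 \<Rightarrow> cmat3)"
    unfolding bilinear_def
    by (auto intro!: linearI simp: vec_eq_iff matrix_matrix_mult_def sum_3 algebra_simps)
  then show ?thesis
    by (simp add: bilinear_conv_bounded_bilinear)
qed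

lemma has_vector_derivative_vec_iff:
  fixes f :: "real \<Rightarrow> 'a::real_normed_vector ^ 'n"
  shows "(f has_vector_derivative f') (at t within S) \<longleftrightarrow>
    (\<forall>i. ((\<lambda>t. f t $ i) has_vector_derivative f' $ i) (at t within S))"
proof
  assume "(f has_vector_derivative f') (at t within S)"
  then show "\<forall>i. ((\<lambda>t. f t $ i) has_vector_derivative f' $ i) (at t within S)"
    using bounded_linear.has_vector_derivative[OF bounded_linear_vec_nth] by blast
next
  assume "\<forall>i. ((\<lambda>t. f t $ i) has_vector_derivative f' $ i) (at t within S)"
  then show "(f has_vector_derivative f') (at t within S)"
    by (auto simp: has_vector_derivative_def has_derivative_within bounded_linear_scaleR_left
        intro: vec_tendstoI)
qed

lemma has_vector_derivative_matrix_iff: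
  fixes f :: "real \<Rightarrow> cmat3"
  shows "(f has_vector_derivative f') (at t within S) \<longleftrightarrow>
    (\<forall>i j. ((\<lambda>t. f t $ i $ j) has_vector_derivative f' $ i $ j) (at t within S))"
  by (simp add: has_vector_derivative_vec_iff)

lemmas has_vector_derivative_matrix_mult =
  bounded_bilinear.has_vector_derivative[OF bounded_bilinear_matrix_mult]

lemma mat_scale_has_vector_derivative:
  assumes "(\<rho> has_vector_derivative \<rho>') (at t within S)" "(N has_vector_derivative N') (at t within S)"
  shows "((\<lambda>t. \<rho> t *\<^sub>m N t) has_vector_derivative \<rho> t *\<^sub>m N' + \<rho>' *\<^sub>m N t) (at t within S)"
  using assms by (auto simp: has_vector_derivative_matrix_iff intro: has_vector_derivative_mult)

lemma matrix_inv_cancel: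
  fixes A B :: cmat3
  assumes "invertible A"
  shows "A ** matrix_inv A = mat 1" "A ** (matrix_inv A ** B) = B"
proof -
  have "A ** matrix_inv A = mat 1 \<and> matrix_inv A ** A = mat 1"
    using assms unfolding invertible_def matrix_inv_def by (rule someI_ex)
  then show "A ** matrix_inv A = mat 1" "A ** (matrix_inv A ** B) = B"
    by (simp_all add: matrix_mul_assoc)
qed

section \<open>The matrix exponential\<close>

lemma mat_power_0 [simp]: "mat_power A 0 = mat 1"
  by (simp add: mat_power_def)

lemma mat_power_Suc [simp]: "mat_power A (Suc n) = A ** mat_power A n"
  by (simp add: mat_power_def)

lemma mat_power_scale: "mat_power (c *\<^sub>m A) n = c ^ n *\<^sub>m mat_power A n"
  by (induction n) (simp_all add: mat_scale_algebra mult_ac)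

lemma mat_power_commute:
  assumes "C ** A = A ** C"
  shows "C ** mat_power A n = mat_power A n ** C"
proof (induction n)
  case (Suc n)
  have "C ** (A ** mat_power A n) = A ** (C ** mat_power A n)"
    by (simp add: matrix_mul_assoc assms)
  with Suc show ?case
    by (simp add: matrix_mul_assoc)
qed simp

text \<open>The product of matrices is a bounded bilinear map, so the norm of the powers grows at most
  geometrically, even though the norm need not be submultiplicative.\<close>

lemma summable_mat_exp: "summable (\<lambda>n. (1 / fact n) *\<^sub>R mat_power A n)"
proof -
  from bounded_bilinear.pos_bounded[OF bounded_bilinear_matrix_mult]
  obtain K where K: "K > 0" "\<And>(A :: cmat3) (B :: cmat3). norm (A ** B) \<le> norm A * norm B * K"
    by auto
  have bound: "norm (mat_power A n) \<le> norm (mat 1 :: cmat3) * (norm A * K) ^ n" for n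
  proof (induction n)
    case (Suc n)
    have "norm (mat_power A (Suc n)) \<le> norm A * norm (mat_power A n) * K"
      by (simp add: K)
    also have "\<dots> \<le> norm A * (norm (mat 1 :: cmat3) * (norm A * K) ^ n) * K"
      using Suc K by (intro mult_mono) auto
    finally show ?case
      by (simp add: mult_ac)
  qed simp
  have "summable (\<lambda>n. norm (mat 1 :: cmat3) * (inverse (fact n) * (norm A * K) ^ n))"
    by (intro summable_mult summable_exp)
  then show ?thesis
  proof (rule summable_comparison_test')
    fix n :: nat
    have "norm ((1 / fact n) *\<^sub>R mat_power A n) = inverse (fact n) * norm (mat_power A n)"
      by (simp add: divide_inverse)
    also have "\<dots> \<le> inverse (fact n) * (norm (mat 1 :: cmat3) * (norm A * K) ^ n)"
      by (intro mult_left_mono bound) auto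
    finally show "norm ((1 / fact n) *\<^sub>R mat_power A n)
        \<le> norm (mat 1 :: cmat3) * (inverse (fact n) * (norm A * K) ^ n)"
      by (simp add: mult_ac)
  qed
qed

lemma mat_exp_sums: "(\<lambda>n. (1 / fact n) *\<^sub>R mat_power A n) sums mat_exp A"
  unfolding mat_exp_def by (rule summable_sums[OF summable_mat_exp])

lemma mat_exp_entry_sums:
  "(\<lambda>n. mat_power A n $ i $ j / fact n) sums (mat_exp A $ i $ j)"
proof -
  have "bounded_linear (\<lambda>A :: cmat3. A $ i $ j)"
    by (rule bounded_linear_compose[OF bounded_linear_vec_nth bounded_linear_vec_nth])
  from bounded_linear.sums[OF this mat_exp_sums[of A]] show ?thesis
    by (simp add: scaleR_conv_of_real[where 'a = complex])
qed

lemma mat_exp_0 [simp]: "mat_exp 0 = mat 1"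
proof -
  have "mat_power 0 n = (if n = 0 then mat 1 else 0)" for n
    by (cases n) simp_all
  then have "mat_exp 0 = (\<Sum>n. if n = 0 then mat 1 else 0)"
    unfolding mat_exp_def by (intro suminf_cong) simp
  also have "\<dots> = mat 1"
    using sums_unique[OF sums_single[of 0 "\<lambda>_. mat 1 :: cmat3"]] by simp
  finally show ?thesis .
qed

lemma mat_exp_commute:
  assumes "C ** A = A ** C"
  shows "C ** mat_exp A = mat_exp A ** C"
proof -
  interpret bounded_bilinear "(**) :: cmat3 \<Rightarrow> cmat3 \<Rightarrow> cmat3"
    by (rule bounded_bilinear_matrix_mult)
  have "(\<lambda>n. C ** ((1 / fact n) *\<^sub>R mat_power A n)) sums (C ** mat_exp A)"
    by (rule bounded_linear.sums[OF bounded_linear_right mat_exp_sums])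
  moreover have "(\<lambda>n. ((1 / fact n) *\<^sub>R mat_power A n) ** C) sums (mat_exp A ** C)"
    by (rule bounded_linear.sums[OF bounded_linear_left mat_exp_sums])
  moreover have "C ** ((1 / fact n) *\<^sub>R mat_power A n) = ((1 / fact n) *\<^sub>R mat_power A n) ** C" for n
    using mat_power_commute[OF assms] by (simp add: scaleR_left scaleR_right)
  ultimately show ?thesis
    using sums_unique2 by force
qed

text \<open>Each entry of \<open>mat_exp (s *\<^sub>m A)\<close> is an entire function of the complex number \<open>s\<close>, which can be
  differentiated termwise. This reduces all differentiation of exponentials to scalar power series.\<close>

lemma mat_exp_has_vector_derivative:
  assumes p: "(p has_vector_derivative p') (at t within S)"
  shows "((\<lambda>t. mat_exp (p t *\<^sub>m A)) has_vector_derivative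
    p' *\<^sub>m (A ** mat_exp (p t *\<^sub>m A))) (at t within S)"
  unfolding has_vector_derivative_matrix_iff
proof (intro allI)
  fix i j
  define c where "c n = mat_power A n $ i $ j / fact n" for n
  have sums: "(\<lambda>n. c n * x ^ n) sums (mat_exp (x *\<^sub>m A) $ i $ j)" for x
    using mat_exp_entry_sums[of "x *\<^sub>m A" i j] by (simp add: c_def mat_power_scale mult_ac)
  have diffs: "diffs c n = (\<Sum>k\<in>UNIV. A $ i $ k * (mat_power A n $ k $ j / fact n))" for n
  proof -
    have "diffs c n = (A ** mat_power A n) $ i $ j / fact n"
      by (simp add: c_def diffs_def del: of_nat_Suc)
    then show ?thesis
      by (simp add: matrix_matrix_mult_def sum_divide_distrib)
  qed
  have "(\<lambda>n. diffs c n * x ^ n) sums ((A ** mat_exp (x *\<^sub>m A)) $ i $ j)" for x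
  proof -
    have "(\<lambda>n. \<Sum>k\<in>UNIV. A $ i $ k * (mat_power (x *\<^sub>m A) n $ k $ j / fact n)) sums
        (\<Sum>k\<in>UNIV. A $ i $ k * mat_exp (x *\<^sub>m A) $ k $ j)"
      by (intro sums_sum sums_mult mat_exp_entry_sums)
    then show ?thesis
      by (simp add: diffs mat_power_scale matrix_matrix_mult_def sum_distrib_left sum_distrib_right mult_ac)
  qed
  then have "((\<lambda>x. mat_exp (x *\<^sub>m A) $ i $ j) has_field_derivative (A ** mat_exp (x *\<^sub>m A)) $ i $ j) (at x)" for x
    using termdiffs_strong_converges_everywhere[of c x] sums
    by (simp add: sums_iff)
  from field_vector_diff_chain_within[OF p this[THEN has_field_derivative_at_within]]
  show "((\<lambda>t. mat_exp (p t *\<^sub>m A) $ i $ j) has_vector_derivative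
      (p' *\<^sub>m (A ** mat_exp (p t *\<^sub>m A))) $ i $ j) (at t within S)"
    by (simp add: o_def)
qed

lemma mat_exp_real_has_vector_derivative:
  "((\<lambda>t. mat_exp (of_real t *\<^sub>m A)) has_vector_derivative A ** mat_exp (of_real t *\<^sub>m A))
    (at t within S)"
proof -
  have "(of_real has_vector_derivative (1 :: complex)) (at t within S)"
    by (auto intro!: derivative_eq_intros)
  from mat_exp_has_vector_derivative[OF this, of A] show ?thesis
    by (simp add: mat_scale_algebra)
qed

lemma matrix_constant_of_derivative_zero:
  fixes R :: "real \<Rightarrow> cmat3"
  assumes "convex S" "\<And>t. t \<in> S \<Longrightarrow> (R has_vector_derivative 0) (at t within S)" "s \<in> S" "t \<in> S"
  shows "R s = R t"
proof -
  obtain c where "\<And>x. x \<in> S \<Longrightarrow> R x = c"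
    using has_vector_derivative_zero_constant[OF assms(1,2)] by blast
  with assms(3,4) show ?thesis by simp
qed

text \<open>For the inverse and for the addition theorem, the quotient of the two sides is followed along
  the scaled arguments \<open>t A\<close>, where it has derivative zero.\<close>

lemma mat_exp_minus_mult: "mat_exp (- A) ** mat_exp A = mat 1"
proof -
  define R where "R t = mat_exp (of_real t *\<^sub>m (- A)) ** mat_exp (of_real t *\<^sub>m A)" for t :: real
  have comm: "A ** mat_exp (of_real t *\<^sub>m (- A)) = mat_exp (of_real t *\<^sub>m (- A)) ** A" for t :: real
    by (rule mat_exp_commute) (simp add: mat_scale_algebra matrix_mult_minus)
  have "(R has_vector_derivative 0) (at t within UNIV)" for t
  proof -
    have "(R has_vector_derivative mat_exp (of_real t *\<^sub>m (- A)) ** (A ** mat_exp (of_real t *\<^sub>m A)) +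
        (- A ** mat_exp (of_real t *\<^sub>m (- A))) ** mat_exp (of_real t *\<^sub>m A)) (at t within UNIV)"
      unfolding R_def
      by (intro has_vector_derivative_matrix_mult mat_exp_real_has_vector_derivative)
    then show ?thesis
      by (simp add: matrix_mult_minus comm matrix_mul_assoc)
  qed
  from matrix_constant_of_derivative_zero[OF convex_UNIV this UNIV_I UNIV_I, of 1 0]
  show ?thesis by (simp add: R_def mat_scale_algebra)
qed

lemma mat_exp_mult_minus: "mat_exp A ** mat_exp (- A) = mat 1"
  using mat_exp_minus_mult[of "- A"] by simp

lemma mat_exp_add:
  assumes AB: "A ** B = B ** A"
  shows "mat_exp (A + B) = mat_exp A ** mat_exp B"
proof -
  define N where "N t = mat_exp (of_real t *\<^sub>m (- (A + B)))" for t :: real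
  define X where "X t = mat_exp (of_real t *\<^sub>m A)" for t :: real
  define Y where "Y t = mat_exp (of_real t *\<^sub>m B)" for t :: real
  have NA: "A ** N t = N t ** A" and NB: "B ** N t = N t ** B" and XB: "B ** X t = X t ** B" for t
    unfolding N_def X_def
    by (intro mat_exp_commute; simp add: mat_scale_algebra matrix_mult_minus AB matrix_mult_add)+
  have "((\<lambda>t. N t ** (X t ** Y t)) has_vector_derivative 0) (at t within UNIV)" for t
  proof -
    have "((\<lambda>t. N t ** (X t ** Y t)) has_vector_derivative
        N t ** (X t ** (B ** Y t) + (A ** X t) ** Y t) + (- (A + B) ** N t) ** (X t ** Y t)) (at t within UNIV)"
      unfolding N_def X_def Y_def
      by (intro has_vector_derivative_matrix_mult mat_exp_real_has_vector_derivative)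
    moreover have "N t ** (X t ** (B ** Y t) + (A ** X t) ** Y t) + (- (A + B) ** N t) ** (X t ** Y t) = 0"
    proof -
      have "X t ** (B ** Y t) = B ** (X t ** Y t)" "(A ** X t) ** Y t = A ** (X t ** Y t)"
        by (simp_all add: matrix_mul_assoc XB)
      then show ?thesis
        by (simp add: matrix_mult_add matrix_mult_minus matrix_mul_assoc NA NB)
    qed
    ultimately show ?thesis
      by simp
  qed
  from matrix_constant_of_derivative_zero[OF convex_UNIV this UNIV_I UNIV_I, of 1 0]
  have "mat_exp (- (A + B)) ** (mat_exp A ** mat_exp B) = mat 1"
    by (simp add: N_def X_def Y_def mat_scale_algebra)
  then have "mat_exp (A + B) ** (mat_exp (- (A + B)) ** (mat_exp A ** mat_exp B)) = mat_exp (A + B)"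
    by (simp only: matrix_mul_rid)
  moreover have "mat_exp (A + B) ** (mat_exp (- (A + B)) ** Z) = Z" for Z :: cmat3
    unfolding matrix_mul_assoc mat_exp_mult_minus by (rule matrix_mul_lid)
  ultimately show ?thesis
    by simp
qed

section \<open>The extended frame\<close>

text \<open>The \<open>dx\<close> and \<open>dy\<close> components \<open>U + V\<close> and \<open>i (U - V)\<close> of the connection form. Since \<open>u\<close> depends on
  \<open>y\<close> only, the diagonal of \<open>U - V\<close> vanishes and \<open>u'\<close> cancels from the second one.\<close>

definition frame_x :: "complex \<Rightarrow> (real \<Rightarrow> real) \<Rightarrow> real \<Rightarrow> complex \<Rightarrow> cmat3"
  where "frame_x \<psi> u y \<nu> = (let h = of_real (exp (u y / 2)) in vector
    [vector [- \<i> * du u y / 2, - \<i> * \<nu> * cnj \<psi> / eu u y, \<i> * h / \<nu>],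
     vector [- \<i> * \<psi> / (\<nu> * eu u y), \<i> * du u y / 2, \<i> * \<nu> * h],
     vector [\<i> * \<nu> * h, \<i> * h / \<nu>, 0]])"

definition frame_y :: "complex \<Rightarrow> (real \<Rightarrow> real) \<Rightarrow> real \<Rightarrow> complex \<Rightarrow> cmat3"
  where "frame_y \<psi> u y \<nu> = (let h = of_real (exp (u y / 2)) in vector
    [vector [0, - \<nu> * cnj \<psi> / eu u y, - h / \<nu>],
     vector [\<psi> / (\<nu> * eu u y), 0, \<nu> * h],
     vector [\<nu> * h, - h / \<nu>, 0]])"

lemma frame_x_entries:
  "frame_x \<psi> u y \<nu> $ 1 $ 1 = - \<i> * du u y / 2"
  "frame_x \<psi> u y \<nu> $ 1 $ 2 = - \<i> * \<nu> * cnj \<psi> / eu u y"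
  "frame_x \<psi> u y \<nu> $ 1 $ 3 = \<i> * of_real (exp (u y / 2)) / \<nu>"
  "frame_x \<psi> u y \<nu> $ 2 $ 1 = - \<i> * \<psi> / (\<nu> * eu u y)"
  "frame_x \<psi> u y \<nu> $ 2 $ 2 = \<i> * du u y / 2"
  "frame_x \<psi> u y \<nu> $ 2 $ 3 = \<i> * \<nu> * of_real (exp (u y / 2))"
  "frame_x \<psi> u y \<nu> $ 3 $ 1 = \<i> * \<nu> * of_real (exp (u y / 2))"
  "frame_x \<psi> u y \<nu> $ 3 $ 2 = \<i> * of_real (exp (u y / 2)) / \<nu>"
  "frame_x \<psi> u y \<nu> $ 3 $ 3 = 0"
  by (simp_all add: frame_x_def Let_def)

lemma frame_y_entries:
  "frame_y \<psi> u y \<nu> $ 1 $ 1 = 0"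
  "frame_y \<psi> u y \<nu> $ 1 $ 2 = - \<nu> * cnj \<psi> / eu u y"
  "frame_y \<psi> u y \<nu> $ 1 $ 3 = - of_real (exp (u y / 2)) / \<nu>"
  "frame_y \<psi> u y \<nu> $ 2 $ 1 = \<psi> / (\<nu> * eu u y)"
  "frame_y \<psi> u y \<nu> $ 2 $ 2 = 0"
  "frame_y \<psi> u y \<nu> $ 2 $ 3 = \<nu> * of_real (exp (u y / 2))"
  "frame_y \<psi> u y \<nu> $ 3 $ 1 = \<nu> * of_real (exp (u y / 2))"
  "frame_y \<psi> u y \<nu> $ 3 $ 2 = - of_real (exp (u y / 2)) / \<nu>"
  "frame_y \<psi> u y \<nu> $ 3 $ 3 = 0"
  by (simp_all add: frame_y_def Let_def)

lemma lift_wirtinger: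
  assumes "u differentiable (at (Im z))"
  shows "d_z (lift u) z = - \<i> * du u (Im z) / 2" "d_zbar (lift u) z = \<i> * du u (Im z) / 2"
proof -
  have "(u has_derivative (\<lambda>h. h * deriv u (Im z))) (at (Im z))"
    using assms
    by (simp flip: DERIV_deriv_iff_real_differentiable add: has_field_derivative_def mult_commute_abs)
  from has_derivative_of_real[OF has_derivative_compose[OF bounded_linear_imp_has_derivative[OF bounded_linear_Im] this]]
  have "(lift u has_derivative (\<lambda>h. of_real (Im h * deriv u (Im z)))) (at z)"
    by (simp add: lift_def[abs_def])
  from frechet_derivative_at[OF this, symmetric]
  show "d_z (lift u) z = - \<i> * du u (Im z) / 2" "d_zbar (lift u) z = \<i> * du u (Im z) / 2"
    by (simp_all add: d_z_def d_zbar_def du_def)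
qed

lemma exp_lift:
  "exp (lift u z / 2) = of_real (exp (u (Im z) / 2))" "exp (- lift u z) = 1 / eu u (Im z)"
proof -
  have "lift u z / 2 = of_real (u (Im z) / 2)" "lift u z = of_real (u (Im z))"
    by (simp_all add: lift_def)
  then show "exp (lift u z / 2) = of_real (exp (u (Im z) / 2))" "exp (- lift u z) = 1 / eu u (Im z)"
    by (simp_all only: exp_of_real exp_minus eu_def inverse_eq_divide)
qed

lemma frame_U_V_combinations:
  assumes "u differentiable (at (Im z))"
  shows "frame_U \<psi> u z \<nu> + frame_V \<psi> u z \<nu> = frame_x \<psi> u (Im z) \<nu>"
    and "\<i> *\<^sub>m (frame_U \<psi> u z \<nu> - frame_V \<psi> u z \<nu>) = frame_y \<psi> u (Im z) \<nu>"
  unfolding vec_eq_iff forall_3 frame_x_entries frame_y_entries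
  by (simp_all add: frame_U_def frame_V_def diag3_def lift_wirtinger[OF assms] exp_lift
      field_simps)

lemma extended_frame_has_derivative:
  assumes ext: "extended_frame \<psi> u F" and \<nu>: "\<nu> \<noteq> 0"
  obtains F' where "((\<lambda>w. F w \<nu>) has_derivative F') (at z)"
    "F' 1 = F z \<nu> ** frame_x \<psi> u (Im z) \<nu>" "F' \<i> = F z \<nu> ** frame_y \<psi> u (Im z) \<nu>"
proof -
  from ext \<nu> have u: "u differentiable (at (Im z))"
    and diff: "(\<lambda>w. F w \<nu>) differentiable (at z)" and inv: "invertible (F z \<nu>)"
    and U: "matrix_inv (F z \<nu>) ** mat_d_z (\<lambda>w. F w \<nu>) z = frame_U \<psi> u z \<nu>"
    and V: "matrix_inv (F z \<nu>) ** mat_d_zbar (\<lambda>w. F w \<nu>) z = frame_V \<psi> u z \<nu>"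
    by (auto simp: extended_frame_def)
  from diff obtain F' where F': "((\<lambda>w. F w \<nu>) has_derivative F') (at z)"
    by (auto simp: differentiable_def)
  have "((\<lambda>w. F w \<nu> $ i $ j) has_derivative (\<lambda>h. F' h $ i $ j)) (at z)" for i j
    by (intro bounded_linear.has_derivative[OF bounded_linear_vec_nth] F')
  from frechet_derivative_at[OF this]
  have d: "frechet_derivative (\<lambda>w. F w \<nu> $ i $ j) (at z) = (\<lambda>h. F' h $ i $ j)" for i j
    by simp
  have "F' 1 = mat_d_z (\<lambda>w. F w \<nu>) z + mat_d_zbar (\<lambda>w. F w \<nu>) z"
    "F' \<i> = \<i> *\<^sub>m (mat_d_z (\<lambda>w. F w \<nu>) z - mat_d_zbar (\<lambda>w. F w \<nu>) z)"
    by (simp_all add: vec_eq_iff mat_d_z_def mat_d_zbar_def d_z_def d_zbar_def d field_simps)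
  moreover have "mat_d_z (\<lambda>w. F w \<nu>) z = F z \<nu> ** frame_U \<psi> u z \<nu>"
    "mat_d_zbar (\<lambda>w. F w \<nu>) z = F z \<nu> ** frame_V \<psi> u z \<nu>"
    by (simp_all add: matrix_inv_cancel[OF inv] flip: U V)
  ultimately have "F' 1 = F z \<nu> ** frame_x \<psi> u (Im z) \<nu>" "F' \<i> = F z \<nu> ** frame_y \<psi> u (Im z) \<nu>"
    by (simp_all add: matrix_mult_add mat_scale_algebra flip: frame_U_V_combinations[OF u])
  with F' show ?thesis by (rule that)
qed

lemma has_derivative_along_line:
  fixes f :: "complex \<Rightarrow> cmat3"
  assumes "(f has_derivative f') (at (w + of_real t * v))"
  shows "((\<lambda>t. f (w + of_real t * v)) has_vector_derivative f' v) (at t within S)"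
proof -
  have "((\<lambda>t. w + of_real t * v) has_derivative (\<lambda>h. of_real h * v)) (at t within S)"
    by (auto intro!: derivative_eq_intros)
  from has_derivative_compose[OF this assms]
  have "((\<lambda>t. f (w + of_real t * v)) has_derivative (\<lambda>h. f' (of_real h * v))) (at t within S)" .
  moreover have "f' (of_real h * v) = h *\<^sub>R f' v" for h
    using linear_scale[OF has_derivative_linear[OF assms], of h v]
    by (simp add: scaleR_conv_of_real)
  ultimately show ?thesis
    by (simp add: has_vector_derivative_def)
qed

lemma frame_has_vector_derivative_y:
  assumes "extended_frame \<psi> u F" "\<nu> \<noteq> 0"
  shows "((\<lambda>t. F (\<i> * of_real t) \<nu>) has_vector_derivative
    F (\<i> * of_real y) \<nu> ** frame_y \<psi> u y \<nu>) (at y within S)"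
proof -
  obtain F' where "((\<lambda>w. F w \<nu>) has_derivative F') (at (0 + of_real y * \<i>))"
    "F' \<i> = F (of_real y * \<i>) \<nu> ** frame_y \<psi> u y \<nu>"
    using extended_frame_has_derivative[OF assms, of "of_real y * \<i>"] by auto
  from has_derivative_along_line[OF this(1), of S] this(2) show ?thesis
    by (simp add: mult.commute)
qed

text \<open>The plus factors of the splitting at \<open>x + i y\<close> and at \<open>i y\<close> are equal, hence they cancel from
  the quotient of the two splittings.\<close>

lemma frame_equivariant:
  assumes ext: "extended_frame \<psi> u F" and spl: "iwasawa_splitting D F Up" and \<nu>: "\<nu> \<noteq> 0"
  shows "F (of_real x + \<i> * of_real y) \<nu> = mat_exp (of_real x *\<^sub>m D \<nu>) ** F (\<i> * of_real y) \<nu>"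
proof -
  have S: "mat_exp (z *\<^sub>m D \<nu>) = F z \<nu> ** Up (Im z) \<nu>" for z
    using spl \<nu> by (simp add: iwasawa_splitting_def)
  have E: "mat_exp ((of_real x + \<i> * of_real y) *\<^sub>m D \<nu>) =
      mat_exp (of_real x *\<^sub>m D \<nu>) ** mat_exp ((\<i> * of_real y) *\<^sub>m D \<nu>)"
    unfolding mat_scale_algebra by (rule mat_exp_add) (simp add: mat_scale_algebra mult.commute)
  \<comment> \<open>\<open>W\<close> is the inverse of the plus factor.\<close>
  define W where "W = mat_exp (- ((\<i> * of_real y) *\<^sub>m D \<nu>)) ** F (\<i> * of_real y) \<nu>"
  have "F (\<i> * of_real y) \<nu> ** (Up y \<nu> ** mat_exp (- ((\<i> * of_real y) *\<^sub>m D \<nu>))) = mat 1"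
    using S[of "\<i> * of_real y"] mat_exp_mult_minus[of "(\<i> * of_real y) *\<^sub>m D \<nu>"]
    by (simp add: matrix_mul_assoc)
  then have "(Up y \<nu> ** mat_exp (- ((\<i> * of_real y) *\<^sub>m D \<nu>))) ** F (\<i> * of_real y) \<nu> = mat 1"
    by (rule iffD1[OF matrix_left_right_inverse])
  then have W: "Up y \<nu> ** W = mat 1"
    by (simp only: W_def matrix_mul_assoc)
  have "F (of_real x + \<i> * of_real y) \<nu> = F (of_real x + \<i> * of_real y) \<nu> ** (Up y \<nu> ** W)"
    by (simp add: W)
  also have "\<dots> = mat_exp ((of_real x + \<i> * of_real y) *\<^sub>m D \<nu>) ** W"
    using S[of "of_real x + \<i> * of_real y"] by (simp add: matrix_mul_assoc)
  also have "\<dots> = mat_exp (of_real x *\<^sub>m D \<nu>) **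
      (mat_exp ((\<i> * of_real y) *\<^sub>m D \<nu>) ** mat_exp (- ((\<i> * of_real y) *\<^sub>m D \<nu>))) **
      F (\<i> * of_real y) \<nu>"
    by (simp only: E W_def matrix_mul_assoc)
  also have "\<dots> = mat_exp (of_real x *\<^sub>m D \<nu>) ** F (\<i> * of_real y) \<nu>"
    by (simp only: mat_exp_mult_minus matrix_mul_rid)
  finally show ?thesis .
qed

text \<open>The derivative in \<open>x\<close> of both sides of the equivariance, taken on the imaginary axis.\<close>

lemma frame_intertwines:
  assumes ext: "extended_frame \<psi> u F" and spl: "iwasawa_splitting D F Up" and \<nu>: "\<nu> \<noteq> 0"
  shows "D \<nu> ** F (\<i> * of_real y) \<nu> = F (\<i> * of_real y) \<nu> ** frame_x \<psi> u y \<nu>"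
proof -
  obtain F' where F': "((\<lambda>w. F w \<nu>) has_derivative F') (at (\<i> * of_real y + of_real 0 * 1))"
    "F' 1 = F (\<i> * of_real y) \<nu> ** frame_x \<psi> u y \<nu>"
    using extended_frame_has_derivative[OF ext \<nu>, of "\<i> * of_real y"] by auto
  have "((\<lambda>t. F (\<i> * of_real y + of_real t * 1) \<nu>) has_vector_derivative
      F (\<i> * of_real y) \<nu> ** frame_x \<psi> u y \<nu>) (at 0)"
    using has_derivative_along_line[OF F'(1), of UNIV] F'(2) by simp
  moreover have "((\<lambda>t. mat_exp (of_real t *\<^sub>m D \<nu>) ** F (\<i> * of_real y) \<nu>) has_vector_derivative
      mat_exp (of_real 0 *\<^sub>m D \<nu>) ** 0 +
        (D \<nu> ** mat_exp (of_real 0 *\<^sub>m D \<nu>)) ** F (\<i> * of_real y) \<nu>) (at 0)"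
    by (intro has_vector_derivative_matrix_mult mat_exp_real_has_vector_derivative
        has_vector_derivative_const)
  ultimately show ?thesis
    using frame_equivariant[OF assms] vector_derivative_unique_at
    by (fastforce simp: add.commute mat_scale_algebra)
qed

definition conj_transpose :: "cmat3 \<Rightarrow> cmat3"
  where "conj_transpose A = transpose (map_matrix cnj A)"

lemma conj_transpose_nth [simp]: "conj_transpose A $ i $ j = cnj (A $ j $ i)"
  by (simp add: conj_transpose_def transpose_def map_matrix_def)

text \<open>At \<open>\<nu> = 1\<close> the frame is unitary, which expresses \<open>frame_x\<close>, and with it \<open>u'\<close>, through the
  differentiable frame. So \<open>u\<close> is twice differentiable although only one derivative is assumed.
  The value comes from \<open>(G\<^sup>* D G)' = A B + B\<^sup>* A\<close>.\<close>

lemma metric_second_derivative: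
  assumes ext: "extended_frame \<psi> u F" and spl: "iwasawa_splitting D F Up"
  shows "(deriv u has_real_derivative 4 * ((cmod \<psi>)\<^sup>2 * exp (- 2 * u y) - exp (u y))) (at y)"
proof -
  define G where "G t = F (\<i> * of_real t) 1" for t :: real
  define A where "A t = frame_x \<psi> u t 1" for t
  define B where "B t = frame_y \<psi> u t 1" for t
  have G: "(G has_vector_derivative G t ** B t) (at t)" for t
    unfolding G_def B_def by (rule frame_has_vector_derivative_y[OF ext]) simp
  have inv: "conj_transpose (G t) ** G t = mat 1" for t
  proof -
    have "G t ** conj_transpose (G t) = mat 1"
      using spl by (auto simp: iwasawa_splitting_def Loop_SU3_def twisted_loops_def SU3_def
          conj_transpose_def G_def)
    then show ?thesis by (rule iffD1[OF matrix_left_right_inverse])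
  qed
  have A: "A t = conj_transpose (G t) ** (D 1 ** G t)" for t
    using frame_intertwines[OF ext spl, of 1 t] inv[of t] by (simp add: A_def G_def matrix_mul_assoc)
  have "((\<lambda>t. conj_transpose (G t)) has_vector_derivative conj_transpose (G t ** B t)) (at t)" for t
    using G[of t] by (auto simp: has_vector_derivative_matrix_iff intro: has_vector_derivative_cnj)
  then have "(A has_vector_derivative
      conj_transpose (G y) ** (D 1 ** (G y ** B y) + 0 ** G y) + conj_transpose (G y ** B y) ** (D 1 ** G y)) (at y)"
    unfolding A by (intro has_vector_derivative_matrix_mult has_vector_derivative_const G)
  moreover have "conj_transpose (G y ** B y) = conj_transpose (B y) ** conj_transpose (G y)"
    by (simp add: vec_eq_iff matrix_matrix_mult_def sum_3 mult.commute)
  ultimately have "(A has_vector_derivative A y ** B y + conj_transpose (B y) ** A y) (at y)"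
    by (simp add: A matrix_mul_assoc)
  then have "((\<lambda>t. A t $ 1 $ 1) has_vector_derivative (A y ** B y + conj_transpose (B y) ** A y) $ 1 $ 1) (at y)"
    unfolding has_vector_derivative_matrix_iff by blast
  also have "(\<lambda>t. A t $ 1 $ 1) = (\<lambda>t. - \<i> * du u t / 2)"
    by (simp add: A_def frame_x_entries)
  also have "(A y ** B y + conj_transpose (B y) ** A y) $ 1 $ 1 =
      2 * \<i> * of_real (exp (u y) - (cmod \<psi>)\<^sup>2 * exp (- 2 * u y))"
  proof -
    have h: "of_real (exp (u y / 2)) * of_real (exp (u y / 2)) = eu u y"
      by (simp add: eu_def flip: of_real_mult exp_add)
    have \<psi>: "of_real ((cmod \<psi>)\<^sup>2) = \<psi> * cnj \<psi>"
      by (rule complex_norm_square)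
    have E: "of_real (exp (- 2 * u y)) = 1 / (eu u y * eu u y)"
    proof -
      have "exp (- 2 * u y) = inverse (exp (u y) * exp (u y))"
        by (simp flip: exp_add exp_minus)
      then show ?thesis
        by (simp add: eu_def divide_inverse)
    qed
    have cnj: "cnj (eu u y) = eu u y"
      by (simp add: eu_def)
    show ?thesis
      unfolding of_real_diff of_real_mult E \<psi>
      by (simp add: matrix_matrix_mult_def sum_3 A_def B_def frame_x_entries frame_y_entries cnj h)
        (simp add: eu_def algebra_simps)
  qed
  finally have "((\<lambda>t. 2 * \<i> * (- \<i> * du u t / 2)) has_vector_derivative
      2 * \<i> * (2 * \<i> * of_real (exp (u y) - (cmod \<psi>)\<^sup>2 * exp (- 2 * u y)))) (at y)"
    by (rule has_vector_derivative_mult_right)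
  then have "((\<lambda>t. Re (2 * \<i> * (- \<i> * du u t / 2))) has_vector_derivative
      Re (2 * \<i> * (2 * \<i> * of_real (exp (u y) - (cmod \<psi>)\<^sup>2 * exp (- 2 * u y))))) (at y)"
    by (rule bounded_linear.has_vector_derivative[OF bounded_linear_Re])
  then show ?thesis
    by (simp add: du_def has_real_derivative_iff_has_vector_derivative algebra_simps)
qed

section \<open>Jacobi elliptic functions\<close>

lemma interval_integral_from_0_has_vector_derivative:
  fixes f :: "real \<Rightarrow> 'a::euclidean_space"
  assumes "a \<le> 0" "0 \<le> b" "continuous_on {a..b} f" "x \<in> {a..b}"
  shows "((\<lambda>t. LBINT s=0..ereal t. f s) has_vector_derivative f x) (at x within {a..b})"
  using interval_integral_FTC2[OF assms(1,2,3), of x] assms(4) by (simp add: zero_ereal_def)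

lemma elliptic_radicand_bounds:
  fixes k :: real
  assumes "k\<^sup>2 < 1"
  shows "0 < 1 - k\<^sup>2 * (sin \<theta>)\<^sup>2" "1 - k\<^sup>2 * (sin \<theta>)\<^sup>2 \<le> 1"
proof -
  have "(sin \<theta>)\<^sup>2 \<le> 1"
    by (simp add: abs_square_le_1)
  then have "k\<^sup>2 * (sin \<theta>)\<^sup>2 \<le> k\<^sup>2 * 1"
    by (intro mult_left_mono) auto
  with assms show "0 < 1 - k\<^sup>2 * (sin \<theta>)\<^sup>2" "1 - k\<^sup>2 * (sin \<theta>)\<^sup>2 \<le> 1"
    by auto
qed

lemma elliptic_F_0 [simp]: "elliptic_F 0 k = 0"
  by (simp add: elliptic_F_def flip: zero_ereal_def)

lemma DERIV_elliptic_F: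
  assumes k: "k\<^sup>2 < 1"
  shows "((\<lambda>\<phi>. elliptic_F \<phi> k) has_real_derivative 1 / sqrt (1 - k\<^sup>2 * (sin \<phi>)\<^sup>2)) (at \<phi>)"
proof -
  define M where "M = \<bar>\<phi>\<bar> + 1"
  have "continuous_on {-M..M} (\<lambda>\<theta>. 1 / sqrt (1 - k\<^sup>2 * (sin \<theta>)\<^sup>2))"
    using elliptic_radicand_bounds(1)[OF k] by (auto intro!: continuous_intros simp: less_le)
  then have "((\<lambda>\<phi>. elliptic_F \<phi> k) has_vector_derivative 1 / sqrt (1 - k\<^sup>2 * (sin \<phi>)\<^sup>2)) (at \<phi> within {-M..M})"
    unfolding elliptic_F_def
    by (intro interval_integral_from_0_has_vector_derivative) (auto simp: M_def)
  moreover have "at \<phi> within {-M..M} = at \<phi>"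
    by (rule at_within_interior) (auto simp: M_def)
  ultimately show ?thesis
    by (simp add: has_real_derivative_iff_has_vector_derivative)
qed

text \<open>The integrand of \<open>elliptic_F\<close> is at least \<open>1\<close>. This one estimate makes \<open>elliptic_F\<close> a bijection
  of the real line and its inverse, the amplitude, Lipschitz continuous.\<close>

lemma elliptic_F_expanding:
  assumes k: "k\<^sup>2 < 1" and "\<phi> \<le> \<phi>'"
  shows "\<phi>' - \<phi> \<le> elliptic_F \<phi>' k - elliptic_F \<phi> k"
proof -
  have "elliptic_F \<phi> k - \<phi> \<le> elliptic_F \<phi>' k - \<phi>'"
  proof (rule DERIV_nonneg_imp_nondecreasing[OF \<open>\<phi> \<le> \<phi>'\<close>])
    fix x
    have "((\<lambda>\<phi>. elliptic_F \<phi> k - \<phi>) has_real_derivative 1 / sqrt (1 - k\<^sup>2 * (sin x)\<^sup>2) - 1) (at x)"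
      by (intro derivative_intros DERIV_elliptic_F k)
    moreover have "1 / sqrt (1 - k\<^sup>2 * (sin x)\<^sup>2) \<ge> 1"
      using elliptic_radicand_bounds[OF k, of x] by simp
    ultimately show "\<exists>y. ((\<lambda>\<phi>. elliptic_F \<phi> k - \<phi>) has_real_derivative y) (at x) \<and> 0 \<le> y"
      by force
  qed
  then show ?thesis by simp
qed

lemma elliptic_F_ex1:
  assumes k: "k\<^sup>2 < 1"
  shows "\<exists>!\<phi>. elliptic_F \<phi> k = x"
proof (rule ex_ex1I)
  have cont: "isCont (\<lambda>\<phi>. elliptic_F \<phi> k) \<phi>" for \<phi>
    using DERIV_elliptic_F[OF k] by (rule DERIV_isCont)
  have "elliptic_F (- \<bar>x\<bar>) k \<le> x" "x \<le> elliptic_F \<bar>x\<bar> k"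
    using elliptic_F_expanding[OF k, of "- \<bar>x\<bar>" 0] elliptic_F_expanding[OF k, of 0 "\<bar>x\<bar>"] by auto
  then show "\<exists>\<phi>. elliptic_F \<phi> k = x"
    using IVT[of "\<lambda>\<phi>. elliptic_F \<phi> k" "- \<bar>x\<bar>" x "\<bar>x\<bar>"] cont by auto
next
  fix \<phi> \<phi>'
  assume "elliptic_F \<phi> k = x" "elliptic_F \<phi>' k = x"
  then show "\<phi> = \<phi>'"
    using elliptic_F_expanding[OF k, of \<phi> \<phi>'] elliptic_F_expanding[OF k, of \<phi>' \<phi>] by linarith
qed

lemma elliptic_F_jacobi_am: "k\<^sup>2 < 1 \<Longrightarrow> elliptic_F (jacobi_am x k) k = x"
  unfolding jacobi_am_def by (rule theI'[OF elliptic_F_ex1])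

lemma jacobi_am_0 [simp]: "k\<^sup>2 < 1 \<Longrightarrow> jacobi_am 0 k = 0"
  unfolding jacobi_am_def by (rule the1_equality[OF elliptic_F_ex1]) simp_all

lemma DERIV_jacobi_am:
  assumes k: "k\<^sup>2 < 1"
  shows "((\<lambda>x. jacobi_am x k) has_real_derivative sqrt (1 - k\<^sup>2 * (sin (jacobi_am x k))\<^sup>2)) (at x)"
proof -
  have nonexpanding: "\<bar>jacobi_am y k - jacobi_am x k\<bar> \<le> \<bar>y - x\<bar>" for x y
    using elliptic_F_expanding[OF k, of "jacobi_am x k" "jacobi_am y k"]
      elliptic_F_expanding[OF k, of "jacobi_am y k" "jacobi_am x k"]
    by (cases "jacobi_am x k \<le> jacobi_am y k") (simp_all add: elliptic_F_jacobi_am[OF k])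
  have cont: "isCont (\<lambda>x. jacobi_am x k) x"
    unfolding continuous_at_eps_delta dist_real_def
    using nonexpanding by (meson le_less_trans)
  have "((\<lambda>x. jacobi_am x k) has_real_derivative
      inverse (1 / sqrt (1 - k\<^sup>2 * (sin (jacobi_am x k))\<^sup>2))) (at x)"
  proof (rule DERIV_inverse_function[OF DERIV_elliptic_F[OF k]])
    show "1 / sqrt (1 - k\<^sup>2 * (sin (jacobi_am x k))\<^sup>2) \<noteq> 0"
      using elliptic_radicand_bounds(1)[OF k, of "jacobi_am x k"] by simp
    show "x - 1 < x" "x < x + 1"
      by simp_all
  qed (simp_all add: elliptic_F_jacobi_am[OF k] cont)
  then show ?thesis by simp
qed

section \<open>The metric\<close>

text \<open>For two solutions the sum \<open>e\<close> of the squares of the differences of values and of derivatives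
  satisfies \<open>|e'| \<le> (1 + |L|) e\<close>, so it stays zero in both directions. The Lipschitz
  bound is asked for only along the two solutions, because the right-hand side of interest is
  quadratic.\<close>

lemma second_order_ode_unique:
  fixes f g f' g' h :: "real \<Rightarrow> real"
  assumes f: "\<And>y. (f has_real_derivative f' y) (at y)"
    and f': "\<And>y. (f' has_real_derivative h (f y)) (at y)"
    and g: "\<And>y. (g has_real_derivative g' y) (at y)"
    and g': "\<And>y. (g' has_real_derivative h (g y)) (at y)"
    and lipschitz: "\<And>y. \<bar>h (f y) - h (g y)\<bar> \<le> L * \<bar>f y - g y\<bar>"
    and init: "f 0 = g 0" "f' 0 = g' 0"
  shows "f y = g y"
proof -
  define e where "e y = (f y - g y)\<^sup>2 + (f' y - g' y)\<^sup>2" for y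
  define e' where "e' y = 2 * (f y - g y) * (f' y - g' y) + 2 * (f' y - g' y) * (h (f y) - h (g y))" for y
  define C where "C = 1 + \<bar>L\<bar>"
  have e: "(e has_real_derivative e' y) (at y)" for y
    unfolding e_def e'_def by (auto intro!: derivative_eq_intros f f' g g' simp: algebra_simps)
  have bound: "\<bar>e' y\<bar> \<le> C * e y" for y
  proof -
    have *: "2 * \<bar>s * t\<bar> \<le> s\<^sup>2 + t\<^sup>2" for s t :: real
      using sum_squares_bound[of "\<bar>s\<bar>" "\<bar>t\<bar>"] by (simp add: abs_mult)
    have "\<bar>e' y\<bar> \<le> 2 * \<bar>(f y - g y) * (f' y - g' y)\<bar> + 2 * \<bar>(f' y - g' y) * (h (f y) - h (g y))\<bar>"
      unfolding e'_def by linarith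
    also have "\<bar>(f' y - g' y) * (h (f y) - h (g y))\<bar> \<le> \<bar>L\<bar> * \<bar>(f y - g y) * (f' y - g' y)\<bar>"
    proof -
      have "\<bar>h (f y) - h (g y)\<bar> \<le> \<bar>L\<bar> * \<bar>f y - g y\<bar>"
        by (rule order_trans[OF lipschitz]) (intro mult_right_mono, auto)
      from mult_left_mono[OF this, of "\<bar>f' y - g' y\<bar>"] show ?thesis
        by (simp add: abs_mult mult_ac)
    qed
    also have "2 * \<bar>(f y - g y) * (f' y - g' y)\<bar> + 2 * (\<bar>L\<bar> * \<bar>(f y - g y) * (f' y - g' y)\<bar>) =
        C * (2 * \<bar>(f y - g y) * (f' y - g' y)\<bar>)"
      by (simp add: C_def algebra_simps)
    also have "\<dots> \<le> C * e y"
      unfolding e_def by (intro mult_left_mono *) (simp add: C_def)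
    finally show ?thesis by simp
  qed
  have nonneg: "e y \<ge> 0"
    by (simp add: e_def)
  have "e y \<le> 0"
  proof (cases "0 \<le> y")
    case True
    have "e y * exp (- C * y) \<le> e 0 * exp (- C * 0)"
    proof (rule DERIV_nonpos_imp_nonincreasing[OF True])
      fix t
      have "((\<lambda>y. e y * exp (- C * y)) has_real_derivative (e' t - C * e t) * exp (- C * t)) (at t)"
        by (auto intro!: derivative_eq_intros e simp: algebra_simps)
      moreover have "(e' t - C * e t) * exp (- C * t) \<le> 0"
        using bound[of t] by (intro mult_nonpos_nonneg) auto
      ultimately show "\<exists>d. ((\<lambda>y. e y * exp (- C * y)) has_real_derivative d) (at t) \<and> d \<le> 0"
        by blast
    qed
    then show ?thesis
      by (simp add: e_def init mult_le_0_iff)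
  next
    case False
    then have "y \<le> 0" by simp
    have "e y * exp (C * y) \<le> e 0 * exp (C * 0)"
    proof (rule DERIV_nonneg_imp_nondecreasing[OF \<open>y \<le> 0\<close>])
      fix t
      have "((\<lambda>y. e y * exp (C * y)) has_real_derivative (e' t + C * e t) * exp (C * t)) (at t)"
        by (auto intro!: derivative_eq_intros e simp: algebra_simps)
      moreover have "(e' t + C * e t) * exp (C * t) \<ge> 0"
        using bound[of t] by (intro mult_nonneg_nonneg) auto
      ultimately show "\<exists>d. ((\<lambda>y. e y * exp (C * y)) has_real_derivative d) (at t) \<and> d \<ge> 0"
        by blast
    qed
    then show ?thesis
      by (simp add: e_def init mult_le_0_iff)
  qed
  with nonneg have "e y = 0" by simp
  then show ?thesis
    by (simp add: e_def sum_power2_eq_zero_iff)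
qed

lemma metric_first_integral:
  fixes u :: "real \<Rightarrow> real"
  assumes u: "\<And>y. (u has_real_derivative u' y) (at y)"
    and u': "\<And>y. (u' has_real_derivative 4 * (m * exp (- 2 * u y) - exp (u y))) (at y)"
    and u'0: "u' 0 = 0"
    and \<beta>: "\<beta> = 2 * exp (u 0) + m * exp (- 2 * u 0)"
  shows "(u' y)\<^sup>2 = 4 * (\<beta> - 2 * exp (u y) - m * exp (- 2 * u y))"
proof -
  define H where "H y = (u' y)\<^sup>2 / 4 + 2 * exp (u y) + m * exp (- 2 * u y)" for y
  have "(H has_real_derivative 0) (at y)" for y
  proof -
    have "(H has_real_derivative 2 * u' y * (4 * (m * exp (- 2 * u y) - exp (u y))) / 4
        + 2 * (exp (u y) * u' y) + m * (exp (- 2 * u y) * (- 2 * u' y))) (at y)"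
      unfolding H_def by (auto intro!: derivative_eq_intros u u')
    then show ?thesis
      by (simp add: field_simps)
  qed
  then have "H y = H 0"
    using DERIV_isconst_all by blast
  then show ?thesis
    by (simp add: H_def u'0 \<beta> field_simps)
qed

text \<open>The last two equations are relations of Vieta for the cubic \<open>\<beta> w\<^sup>2 - 2 w\<^sup>3 - |\<psi>|\<^sup>2\<close> with the roots
  \<open>a\<^sub>1\<close>, \<open>a\<^sub>2\<close> and \<open>- a\<^sub>3\<close>: the sum of the roots, and their second elementary symmetric function, which
  vanishes because the cubic has no linear term.\<close>

lemma elliptic_parameters:
  assumes "a * b \<noteq> 0"
  shows "par_a1 a > 0" "par_a2 a b > 0" "par_a3 a b > 0"
    "par_beta a b = 2 * (par_a1 a + par_a2 a b - par_a3 a b)"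
    "par_a1 a * par_a2 a b - par_a1 a * par_a3 a b - par_a2 a b * par_a3 a b = 0"
proof -
  define a1 where "a1 = par_a1 a"
  define c where "c = par_c a b"
  define R where "R = sqrt (c\<^sup>2 + 4 * a1 * c)"
  have a1: "a1 > 0"
    using assms by (simp add: a1_def par_a1_def)
  have c: "c > 0" "par_beta a b = 2 * (a1 + c)"
    using assms by (simp_all add: c_def a1_def par_c_def par_beta_def par_a1_def)
  have a23: "par_a2 a b = (c + R) / 2" "par_a3 a b = (- c + R) / 2"
    by (simp_all add: par_a2_def par_a3_def R_def c_def a1_def)
  have "sqrt (c\<^sup>2) < R"
    unfolding R_def using a1 c by (intro real_sqrt_less_mono) simp
  then have R: "c < R"
    using c by simp
  have R2: "R * R = c\<^sup>2 + 4 * a1 * c"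
    unfolding R_def using a1 c by simp
  show "par_a1 a > 0" "par_a2 a b > 0" "par_a3 a b > 0"
    using a1 c R by (simp_all add: a23 flip: a1_def)
  show "par_beta a b = 2 * (par_a1 a + par_a2 a b - par_a3 a b)"
    by (simp add: a23 c field_simps flip: a1_def)
  have "par_a2 a b * par_a3 a b = (R * R - c * c) / 4"
    by (simp add: a23 field_simps)
  also have "\<dots> = a1 * (par_a2 a b - par_a3 a b)"
    by (simp add: R2 a23 power2_eq_square field_simps)
  finally show "par_a1 a * par_a2 a b - par_a1 a * par_a3 a b - par_a2 a b * par_a3 a b = 0"
    by (simp add: right_diff_distrib flip: a1_def)
qed

text \<open>The second-order equation is essential here: the first integral
  \<open>w'\<^sup>2 = 8 (a\<^sub>1 - w) (w - a\<^sub>2) (w + a\<^sub>3)\<close> is also satisfied by the constant \<open>a\<^sub>1\<close>. The bounds on \<open>w\<close>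
  make the quadratic right-hand side Lipschitz.\<close>

lemma metric_explicit:
  fixes a1 a2 a3 k r :: real
  assumes pos: "a1 > 0" "a2 > 0" "a3 > 0" and a12: "a1 > a2"
    and \<beta>: "\<beta> = 2 * (a1 + a2 - a3)"
    and rel: "a1 * a2 - a1 * a3 - a2 * a3 = 0"
    and k: "k\<^sup>2 = (a1 - a2) / (a1 + a3)" and r: "r\<^sup>2 = 2 * (a1 + a3)"
    and w: "\<And>y. (w has_real_derivative w' y) (at y)"
    and w': "\<And>y. (w' has_real_derivative 4 * \<beta> * w y - 12 * (w y)\<^sup>2) (at y)"
    and bounds: "\<And>y. 0 \<le> w y" "\<And>y. w y \<le> a1"
    and init: "w 0 = a1" "w' 0 = 0"
  shows "w y = a1 - (a1 - a2) * (jacobi_sn (r * y) k)\<^sup>2"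
proof -
  have k1: "k\<^sup>2 < 1"
    using pos a12 by (simp add: k)
  define d where "d = a1 - a2"
  define \<phi> where "\<phi> y = jacobi_am (r * y) k" for y
  define \<Delta> where "\<Delta> y = sqrt (1 - k\<^sup>2 * (sin (\<phi> y))\<^sup>2)" for y
  define v where "v y = a1 - d * (sin (\<phi> y))\<^sup>2" for y
  define v' where "v' y = - 2 * d * r * (sin (\<phi> y) * cos (\<phi> y) * \<Delta> y)" for y
  have \<Delta>_pos: "\<Delta> y > 0" for y
    unfolding \<Delta>_def using elliptic_radicand_bounds(1)[OF k1] by simp
  have \<Delta>2: "(\<Delta> y)\<^sup>2 = 1 - k\<^sup>2 * (sin (\<phi> y))\<^sup>2" for y
    unfolding \<Delta>_def using elliptic_radicand_bounds(1)[OF k1, of "\<phi> y"] by simp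
  have \<phi>: "(\<phi> has_real_derivative r * \<Delta> y) (at y)" for y
  proof -
    have "((\<lambda>y. r * y) has_real_derivative r) (at y)"
      by (auto intro!: derivative_eq_intros)
    from DERIV_chain2[OF DERIV_jacobi_am[OF k1] this] show ?thesis
      by (simp add: \<phi>_def[abs_def] \<Delta>_def mult.commute)
  qed
  have \<Delta>: "(\<Delta> has_real_derivative - k\<^sup>2 * sin (\<phi> y) * cos (\<phi> y) * r) (at y)" for y
  proof -
    have "((\<lambda>y. 1 - k\<^sup>2 * (sin (\<phi> y))\<^sup>2) has_real_derivative
        - 2 * k\<^sup>2 * sin (\<phi> y) * (cos (\<phi> y) * (r * \<Delta> y))) (at y)"
      by (auto intro!: derivative_eq_intros \<phi>)
    from DERIV_chain2[OF DERIV_real_sqrt[OF elliptic_radicand_bounds(1)[OF k1]] this]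
    have "(\<Delta> has_real_derivative
        inverse (\<Delta> y) / 2 * (- 2 * k\<^sup>2 * sin (\<phi> y) * (cos (\<phi> y) * (r * \<Delta> y)))) (at y)"
      unfolding \<Delta>_def .
    then show ?thesis
      using \<Delta>_pos[of y] by (simp add: field_simps)
  qed
  have v: "(v has_real_derivative v' y) (at y)" for y
    unfolding v_def v'_def by (auto intro!: derivative_eq_intros \<phi>)
  \<comment> \<open>Both sides are quadratic polynomials in \<open>S = sin\<^sup>2 \<phi>\<close> because \<open>k\<^sup>2 r\<^sup>2 = 2 d\<close>; their constant terms agree by \<open>rel\<close>.\<close>
  have v': "(v' has_real_derivative 4 * \<beta> * v y - 12 * (v y)\<^sup>2) (at y)" for y
  proof -
    define S where "S = (sin (\<phi> y))\<^sup>2"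
    have C: "(cos (\<phi> y))\<^sup>2 = 1 - S"
      by (simp add: S_def cos_squared_eq)
    have kr: "k\<^sup>2 * r\<^sup>2 = 2 * d"
      using pos by (simp add: k r d_def field_simps)
    have "(v' has_real_derivative
        - 2 * d * r * ((cos (\<phi> y) * (r * \<Delta> y) * cos (\<phi> y) + sin (\<phi> y) * (- sin (\<phi> y) * (r * \<Delta> y))) * \<Delta> y
          + sin (\<phi> y) * cos (\<phi> y) * (- k\<^sup>2 * sin (\<phi> y) * cos (\<phi> y) * r))) (at y)"
      unfolding v'_def by (rule derivative_eq_intros \<phi> \<Delta> refl)+ (simp add: algebra_simps)
    also have "- 2 * d * r * ((cos (\<phi> y) * (r * \<Delta> y) * cos (\<phi> y) + sin (\<phi> y) * (- sin (\<phi> y) * (r * \<Delta> y))) * \<Delta> y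
          + sin (\<phi> y) * cos (\<phi> y) * (- k\<^sup>2 * sin (\<phi> y) * cos (\<phi> y) * r))
      = - 2 * d * r\<^sup>2 * (((cos (\<phi> y))\<^sup>2 - (sin (\<phi> y))\<^sup>2) * (\<Delta> y)\<^sup>2 - k\<^sup>2 * (sin (\<phi> y))\<^sup>2 * (cos (\<phi> y))\<^sup>2)"
      by (simp add: power2_eq_square algebra_simps)
    also have "\<dots> = - 2 * d * r\<^sup>2 * ((1 - S - S) * (1 - k\<^sup>2 * S) - k\<^sup>2 * S * (1 - S))"
      by (simp only: C \<Delta>2 S_def[symmetric])
    also have "\<dots> = - 2 * d * (r\<^sup>2 * (1 - 2 * S) - 2 * (k\<^sup>2 * r\<^sup>2) * S + 3 * (k\<^sup>2 * r\<^sup>2) * S\<^sup>2)"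
      by (simp add: power2_eq_square algebra_simps)
    also have "\<dots> = 4 * \<beta> * (a1 - d * S) - 12 * (a1 - d * S)\<^sup>2"
      unfolding kr unfolding r \<beta> d_def using rel by (simp add: power2_eq_square algebra_simps)
    finally show ?thesis
      by (simp add: v_def S_def)
  qed
  have v_bounds: "0 \<le> v y" "v y \<le> a1" for y
  proof -
    have "d > 0" "d < a1"
      using a12 pos by (simp_all add: d_def)
    moreover have "d * (sin (\<phi> y))\<^sup>2 \<le> d * 1"
      using \<open>d > 0\<close> by (intro mult_left_mono) (auto simp: abs_square_le_1)
    moreover have "0 \<le> d * (sin (\<phi> y))\<^sup>2"
      using \<open>d > 0\<close> by simp
    ultimately show "0 \<le> v y" "v y \<le> a1"
      unfolding v_def by linarith+
  qed
  have lipschitz: "\<bar>(4 * \<beta> * w y - 12 * (w y)\<^sup>2) - (4 * \<beta> * v y - 12 * (v y)\<^sup>2)\<bar> \<le>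
      (4 * \<bar>\<beta>\<bar> + 24 * a1) * \<bar>w y - v y\<bar>" for y
  proof -
    have "(4 * \<beta> * w y - 12 * (w y)\<^sup>2) - (4 * \<beta> * v y - 12 * (v y)\<^sup>2) =
        (4 * \<beta> - 12 * (w y + v y)) * (w y - v y)"
      by (simp add: power2_eq_square algebra_simps)
    moreover have "\<bar>4 * \<beta> - 12 * (w y + v y)\<bar> \<le> 4 * \<bar>\<beta>\<bar> + 24 * a1"
      using bounds[of y] v_bounds[of y] abs_triangle_ineq4[of "4 * \<beta>" "12 * (w y + v y)"]
      by (simp add: abs_mult)
    ultimately show ?thesis
      by (simp add: abs_mult mult_right_mono)
  qed
  have "w y = v y"
  proof (rule second_order_ode_unique[where h = "\<lambda>x. 4 * \<beta> * x - 12 * x\<^sup>2", OF w w' v v' lipschitz])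
    show "w 0 = v 0" "w' 0 = v' 0"
      using k1 by (simp_all add: v_def v'_def \<phi>_def init)
  qed
  then show ?thesis
    by (simp add: v_def d_def \<phi>_def jacobi_sn_def)
qed

section \<open>The gauge\<close>

text \<open>\<open>Q_mat\<close> without its scalar factor \<open>\<nu>\<^sup>3 / \<kappa>\<close>, as a rational function of \<open>h = exp (u / 2)\<close> and
  \<open>U = u'\<close>, with \<open>x\<close> and \<open>z\<close> standing for \<open>\<nu>\<^sup>3 cnj \<psi>\<close> and \<open>\<psi> / \<nu>\<^sup>3\<close>. It uses that \<open>a\<close> is purely
  imaginary, so that \<open>|a|\<^sup>2 = - a\<^sup>2\<close>.\<close>

definition Q_num :: "complex \<Rightarrow> complex \<Rightarrow> complex \<Rightarrow> complex \<Rightarrow> complex \<Rightarrow> complex \<Rightarrow> cmat3"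
  where "Q_num a \<nu> x z h U = vector
    [vector [\<i> / a * (h * (a\<^sup>2 * U / 2 - z) - x * a\<^sup>2 / h),
             \<i> / (a * \<nu>\<^sup>2) * (h * a\<^sup>2 * U / 2 - x * (a\<^sup>2 / h + h)),
             - 2 / \<nu> * h * (a\<^sup>2 + h\<^sup>2)],
     vector [\<i> * \<nu>\<^sup>2 / a * (h * a\<^sup>2 * U / 2 + z * (a\<^sup>2 / h + h)),
             \<i> / a * (h * a\<^sup>2 * U / 2 + x * h + z * a\<^sup>2 / h),
             2 * \<nu> * h * (a\<^sup>2 + h\<^sup>2)],
     vector [0, 0, x - z - h\<^sup>2 * U]]"

text \<open>The coefficient matrix of the linear equation \<open>c Q_num' = Q_generator Q_num\<close>, where \<open>c\<close> is the
  lower right entry of \<open>Q_num\<close>.\<close>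

definition Q_generator :: "complex \<Rightarrow> complex \<Rightarrow> complex \<Rightarrow> complex \<Rightarrow> complex \<Rightarrow> cmat3"
  where "Q_generator \<nu> x z h U = vector
    [vector [2 * h^4 - 2 * x * z / h\<^sup>2 - h\<^sup>2 * U\<^sup>2 / 2 - (x + z) * U / 2,
             (2 * h^4 - 2 * x * z / h\<^sup>2 - x * U) / \<nu>\<^sup>2,
             - 2 * h^3 * U / \<nu>],
     vector [(2 * h^4 - 2 * x * z / h\<^sup>2 + z * U) * \<nu>\<^sup>2,
             2 * h^4 - 2 * x * z / h\<^sup>2 - h\<^sup>2 * U\<^sup>2 / 2 + (x + z) * U / 2,
             2 * \<nu> * h^3 * U],
     vector [0, 0, 4 * h^4 - h\<^sup>2 * U\<^sup>2 - 4 * x * z / h\<^sup>2]]"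

text \<open>The formal derivative of \<open>Q_num\<close> along a curve with \<open>h' = U h / 2\<close> and with \<open>U'\<close> as an independent
  argument.\<close>

definition Q_num_deriv :: "complex \<Rightarrow> complex \<Rightarrow> complex \<Rightarrow> complex \<Rightarrow> complex \<Rightarrow> complex \<Rightarrow> complex \<Rightarrow> cmat3"
  where "Q_num_deriv a \<nu> x z h U U' = vector
    [vector [\<i> / a * (U / 2 * h * (a\<^sup>2 * U / 2 - z) + h * a\<^sup>2 * U' / 2 + x * a\<^sup>2 * (U / 2 / h)),
             \<i> / (a * \<nu>\<^sup>2) * (a\<^sup>2 / 2 * (U / 2 * h * U + h * U') - x * (U / 2 * h - a\<^sup>2 * (U / 2 / h))),
             - 2 / \<nu> * (U / 2 * h * (a\<^sup>2 + h\<^sup>2) + h * (U * h\<^sup>2))],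
     vector [\<i> * \<nu>\<^sup>2 / a * (a\<^sup>2 / 2 * (U / 2 * h * U + h * U') + z * (U / 2 * h - a\<^sup>2 * (U / 2 / h))),
             \<i> / a * (a\<^sup>2 / 2 * (U / 2 * h * U + h * U') + x * (U / 2 * h) - z * a\<^sup>2 * (U / 2 / h)),
             2 * \<nu> * (U / 2 * h * (a\<^sup>2 + h\<^sup>2) + h * (U * h\<^sup>2))],
     vector [0, 0, - (U * h\<^sup>2 * U + h\<^sup>2 * U')]]"

text \<open>The value of \<open>U'\<close> is the second derivative of the metric, since \<open>x z = |\<psi>|\<^sup>2\<close>. With it the equation
  is an identity of rational functions that holds for all values of \<open>h\<close> and \<open>U\<close>; the first
  integral enters only when \<open>Q_generator\<close> is compared with the connection.\<close>

lemma Q_num_deriv_eq: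
  assumes "a \<noteq> 0" "\<nu> \<noteq> 0" "h \<noteq> 0"
  shows "(x - z - h\<^sup>2 * U) *\<^sub>m Q_num_deriv a \<nu> x z h U (4 * (x * z / h^4 - h\<^sup>2)) =
    Q_generator \<nu> x z h U ** Q_num a \<nu> x z h U"
  unfolding vec_eq_iff forall_3 matrix_matrix_mult_def sum_3 mat_scale_nth vec_lambda_beta
    Q_num_deriv_def Q_generator_def Q_num_def vector_3
  using assms by (intro conjI; simp add: field_simps power2_eq_square power3_eq_cube power4_eq_xxxx)

lemma Q_num_has_vector_derivative:
  fixes h U :: "real \<Rightarrow> complex"
  assumes h: "(h has_vector_derivative U t / 2 * h t) (at t within S)"
    and hi: "((\<lambda>t. 1 / h t) has_vector_derivative - (U t / 2 / h t)) (at t within S)"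
    and U: "(U has_vector_derivative U') (at t within S)"
  shows "((\<lambda>t. Q_num a \<nu> x z (h t) (U t)) has_vector_derivative Q_num_deriv a \<nu> x z (h t) (U t) U')
    (at t within S)"
proof -
  define k where "k t = 1 / h t" for t
  have k: "(k has_vector_derivative - (U t / 2 * k t)) (at t within S)"
    using hi by (simp add: k_def[abs_def])
  have div: "w / h t = w * k t" for w t
    by (simp add: k_def)
  show ?thesis
    unfolding has_vector_derivative_matrix_iff forall_3 Q_num_def Q_num_deriv_def vector_3 div power2_eq_square
    by (intro conjI; rule has_vector_derivative_eq_rhs, (rule derivative_intros k h U)+,
        simp add: algebra_simps add_divide_distrib diff_divide_distrib)
qed

section \<open>The branch of \<open>\<kappa>\<close>\<close>

lemma has_vector_derivative_exp:
  fixes g :: "real \<Rightarrow> complex"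
  assumes "(g has_vector_derivative g') (at t within S)"
  shows "((\<lambda>t. exp (g t)) has_vector_derivative g' * exp (g t)) (at t within S)"
  using field_vector_diff_chain_within[OF assms DERIV_exp[THEN has_field_derivative_at_within]]
  by (simp add: o_def)

text \<open>The quotient of two branches is a continuous cube root of unity.\<close>

lemma kappa_branch_unique:
  assumes "kappa_branch \<psi> u y \<nu> \<kappa>1" "kappa_branch \<psi> u y \<nu> \<kappa>2"
    and nz: "\<And>s. s \<in> closed_segment 0 y \<Longrightarrow> \<kappa>1 s \<noteq> 0"
  shows "\<kappa>2 y = \<kappa>1 y"
proof -
  let ?S = "closed_segment 0 y"
  define \<rho> where "\<rho> s = \<kappa>2 s / \<kappa>1 s" for s
  have "continuous_on ?S \<rho>"
    unfolding \<rho>_def using assms by (intro continuous_intros) (auto simp: kappa_branch_def)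
  moreover have "\<rho> s ^ 3 = 1" if "s \<in> ?S" for s
    using assms(1,2) nz[OF that] that by (auto simp: kappa_branch_def \<rho>_def power_divide)
  then have "finite (\<rho> ` ?S)"
    by (intro finite_subset[OF _ finite_roots_unity[of 3]]) auto
  ultimately have "\<rho> constant_on ?S"
    by (intro continuous_finite_range_constant connected_segment)
  then have "\<rho> y = \<rho> 0"
    by (metis constant_on_def ends_in_segment)
  also have "\<rho> 0 = 1"
    using assms(1,2) nz[of 0] by (auto simp: kappa_branch_def \<rho>_def)
  finally show ?thesis
    using nz[of y] by (simp add: \<rho>_def)
qed

text \<open>Let \<open>g\<close> be the integral of \<open>c' / c\<close>, a logarithm of \<open>c / c 0\<close>. Then the branch is
  \<open>\<nu>\<^sup>3 c 0 exp (2 g / 3)\<close>, which shows that it exists and has logarithmic derivative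
  \<open>(2 / 3) c' / c\<close>.\<close>

lemma kappa_has_vector_derivative:
  assumes \<nu>: "\<nu> \<noteq> 0" and u0: "du u 0 = 0" and t: "t \<in> closed_segment 0 y"
    and c': "\<And>s. s \<in> closed_segment 0 y \<Longrightarrow>
      ((\<lambda>s. c_check \<psi> u s \<nu>) has_vector_derivative c' s) (at s within closed_segment 0 y)"
    and cont: "continuous_on (closed_segment 0 y) c'"
    and nz: "\<And>s. s \<in> closed_segment 0 y \<Longrightarrow> c_check \<psi> u s \<nu> \<noteq> 0"
  shows "((\<lambda>s. kappa \<psi> u s \<nu>) has_vector_derivative
      2 / 3 * (c' t / c_check \<psi> u t \<nu>) * kappa \<psi> u t \<nu>) (at t within closed_segment 0 y)"
    and "kappa \<psi> u t \<nu> \<noteq> 0"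
    and "kappa \<psi> u 0 \<nu> = \<nu>^3 * c_check \<psi> u 0 \<nu>"
proof -
  define S where "S = closed_segment 0 y"
  have S: "S = {min 0 y..max 0 y}"
    by (auto simp: S_def closed_segment_eq_real_ivl)
  define c where "c s = c_check \<psi> u s \<nu>" for s
  define g where "g t = (LBINT s=0..ereal t. c' s / c s)" for t
  define K where "K t = \<nu>^3 * c 0 * exp (2 / 3 * g t)" for t
  have c': "(c has_vector_derivative c' s) (at s within S)" and nz: "c s \<noteq> 0" if "s \<in> S" for s
    using c' nz that by (simp_all add: S_def c_def[abs_def])
  have cont_c: "continuous_on S c"
    using c'[THEN has_vector_derivative_continuous] by (simp add: continuous_on_eq_continuous_within)
  have "continuous_on S (\<lambda>s. c' s / c s)"
    using cont cont_c nz by (auto intro!: continuous_intros simp: S_def)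
  then have g: "(g has_vector_derivative c' s / c s) (at s within S)" if "s \<in> S" for s
    unfolding g_def S by (intro interval_integral_from_0_has_vector_derivative) (use that S in auto)
  have g0: "g 0 = 0"
    by (simp add: g_def flip: zero_ereal_def)
  have c_exp: "c s = c 0 * exp (g s)" if "s \<in> S" for s
  proof -
    have "((\<lambda>s. c s * exp (- g s)) has_vector_derivative 0) (at s within S)" if "s \<in> S" for s
    proof -
      have "((\<lambda>s. c s * exp (- g s)) has_vector_derivative
          c s * (- (c' s / c s) * exp (- g s)) + c' s * exp (- g s)) (at s within S)"
        using c'[OF that] g[OF that]
        by (intro has_vector_derivative_mult has_vector_derivative_exp has_vector_derivative_minus)
      then show ?thesis
        using nz[OF that] by simp
    qed
    then obtain C where C: "\<And>s. s \<in> S \<Longrightarrow> c s * exp (- g s) = C"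
      using has_vector_derivative_zero_constant[of S "\<lambda>s. c s * exp (- g s)"] convex_closed_segment[of 0 y]
      unfolding S_def[symmetric] by blast
    have "c s * exp (- g s) = c 0"
      using C[of s] C[of 0] that g0 by (simp add: S_def)
    then show ?thesis
      by (simp add: exp_minus field_simps)
  qed
  have K: "(K has_vector_derivative 2 / 3 * (c' s / c s) * K s) (at s within S)" if "s \<in> S" for s
  proof -
    have "(K has_vector_derivative \<nu>^3 * c 0 * (2 / 3 * (c' s / c s) * exp (2 / 3 * g s))) (at s within S)"
      unfolding K_def by (intro has_vector_derivative_mult_right has_vector_derivative_exp g that)
    then show ?thesis
      by (simp add: K_def mult_ac)
  qed
  have K_nz: "K s \<noteq> 0" for s
    using \<nu> nz[of 0] by (simp add: K_def S_def)
  have \<nu>c: "\<nu>^6 * cnj \<psi> - \<psi> - \<nu>^3 * eu u s * du u s = \<nu>^3 * c s" for s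
    using \<nu> by (simp add: c_def c_check_def field_simps flip: power_add)
  have \<nu>c0: "\<nu>^6 * cnj \<psi> - \<psi> = \<nu>^3 * c 0"
    using \<nu>c[of 0] by (simp add: u0)
  have kappa_K: "kappa \<psi> u s \<nu> = K s" if "s \<in> S" for s
  proof -
    have sub: "closed_segment 0 s \<subseteq> S"
      using that by (simp add: S_def subset_closed_segment)
    have branch: "kappa_branch \<psi> u s \<nu> K"
      unfolding kappa_branch_def
    proof (intro conjI ballI)
      have "continuous_on S K"
        using K[THEN has_vector_derivative_continuous] by (simp add: continuous_on_eq_continuous_within)
      then show "continuous_on (closed_segment 0 s) K"
        using sub by (rule continuous_on_subset)
      show "K 0 = \<nu>^6 * cnj \<psi> - \<psi>"
        by (simp add: K_def g0 \<nu>c0)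
    next
      fix r assume "r \<in> closed_segment 0 s"
      then have "c r = c 0 * exp (g r)"
        using sub c_exp by blast
      moreover have "exp (2 / 3 * g r) ^ 3 = exp (g r) ^ 2"
        by (simp flip: exp_of_nat_mult)
      ultimately have "K r ^ 3 = (\<nu>^3 * c r)\<^sup>2 * (\<nu>^3 * c 0)"
        by (simp add: K_def power_mult_distrib power2_eq_square power3_eq_cube mult.assoc)
      also have "\<dots> = (\<nu>^6 * cnj \<psi> - \<psi> - \<nu>^3 * eu u r * du u r)\<^sup>2 * (\<nu>^6 * cnj \<psi> - \<psi>)"
        by (rule arg_cong2[OF \<nu>c[symmetric] \<nu>c0[symmetric]])
      finally show "K r ^ 3 = (\<nu>^6 * cnj \<psi> - \<psi> - \<nu>^3 * eu u r * du u r)\<^sup>2 * (\<nu>^6 * cnj \<psi> - \<psi>)" .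
    qed
    show ?thesis
      unfolding kappa_def
    proof (rule the_equality)
      show "\<exists>\<kappa>. kappa_branch \<psi> u s \<nu> \<kappa> \<and> \<kappa> s = K s"
        using branch by blast
    next
      fix w assume "\<exists>\<kappa>. kappa_branch \<psi> u s \<nu> \<kappa> \<and> \<kappa> s = w"
      then obtain \<kappa> where "kappa_branch \<psi> u s \<nu> \<kappa>" "\<kappa> s = w"
        by blast
      with kappa_branch_unique[OF branch _ K_nz] show "w = K s"
        by blast
    qed
  qed
  have "t \<in> S" "0 \<in> S"
    using t by (simp_all add: S_def)
  then show "kappa \<psi> u t \<nu> \<noteq> 0" "kappa \<psi> u 0 \<nu> = \<nu>^3 * c_check \<psi> u 0 \<nu>"
    by (simp_all add: kappa_K K_nz) (simp add: K_def g0 c_def)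
  show "((\<lambda>s. kappa \<psi> u s \<nu>) has_vector_derivative
      2 / 3 * (c' t / c_check \<psi> u t \<nu>) * kappa \<psi> u t \<nu>) (at t within closed_segment 0 y)"
    using has_vector_derivative_transform[OF \<open>t \<in> S\<close> kappa_K K[OF \<open>t \<in> S\<close>]] \<open>t \<in> S\<close>
    by (simp add: kappa_K c_def S_def)
qed

section \<open>The explicit frame\<close>

lemma exp_half_metric:
  fixes u :: "real \<Rightarrow> real"
  defines "h \<equiv> \<lambda>y. complex_of_real (exp (u y / 2))"
  shows "h y \<noteq> 0" "eu u y = (h y)\<^sup>2" "of_real (exp (- u y / 2)) = 1 / h y"
proof -
  show "h y \<noteq> 0"
    by (simp add: h_def)
  have "exp (u y) = (exp (u y / 2))\<^sup>2"
    by (simp add: power2_eq_square flip: exp_add)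
  then show "eu u y = (h y)\<^sup>2"
    by (simp add: h_def eu_def)
  have "exp (- u y / 2) = 1 / exp (u y / 2)"
    using exp_minus[of "u y / 2"] by (simp add: inverse_eq_divide)
  then show "of_real (exp (- u y / 2)) = 1 / h y"
    unfolding h_def by simp
qed

lemma Q_mat_eq_Q_num:
  assumes a: "a \<noteq> 0" "cnj a = - a" and \<nu>: "\<nu> \<noteq> 0"
  shows "Q_mat a \<psi> u y \<nu> = (\<nu>^3 / kappa \<psi> u y \<nu>) *\<^sub>m
    Q_num a \<nu> (\<nu>^3 * cnj \<psi>) (\<psi> / \<nu>^3) (of_real (exp (u y / 2))) (du u y)"
proof -
  define h where "h = complex_of_real (exp (u y / 2))"
  define x where "x = \<nu>^3 * cnj \<psi>"
  define z where "z = \<psi> / \<nu>^3"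
  have h: "h \<noteq> 0" "eu u y = h\<^sup>2" "of_real (exp (- u y / 2)) = 1 / h"
    using exp_half_metric[of u y] by (simp_all add: h_def)
  have A: "of_real ((cmod a)\<^sup>2) = - (a * a)"
    using complex_norm_square[of a] by (simp add: a)
  show ?thesis
    unfolding Q_mat_def Q_zero_def Q_tilde_def Let_def mat_scale_algebra(2) c_check_def A h(2,3) a(2)
      h_def[symmetric] x_def[symmetric] z_def[symmetric]
    unfolding Q_num_def diag3_def vec_eq_iff forall_3 mat_scale_nth matrix_matrix_mult_def sum_3 vec_lambda_beta vector_3
    using a(1) h(1) \<nu>
    by (intro conjI arg_cong2[of _ _ _ _ "(*)"] refl; simp add: field_simps power2_eq_square)
qed

text \<open>Up to the scalar \<open>(2 / 3) c'\<close>, which is removed by \<open>\<kappa>\<close>, the generator is \<open>c\<close> times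
  \<open>(i - \<beta>\<^sub>1') A - \<beta>\<^sub>2' (A\<^sup>2 + 2 \<beta> / 3) - B\<close>. The first integral is used to eliminate \<open>\<beta>\<close>; the scalar in
  the last line is \<open>c'\<close> after \<open>u''\<close> has been replaced by its value.\<close>

lemma Q_generator_eq_connection:
  assumes \<nu>: "\<nu> \<noteq> 0"
    and \<beta>: "(du u y)\<^sup>2 = 4 * (\<beta> - 2 * eu u y - \<psi> * cnj \<psi> / (eu u y)\<^sup>2)"
  shows "Q_generator \<nu> (\<nu>^3 * cnj \<psi>) (\<psi> / \<nu>^3) (of_real (exp (u y / 2))) (du u y) =
      (\<i> * c_check \<psi> u y \<nu> - (2 * \<i> * \<nu>^3 * cnj \<psi> - \<i> * du u y * eu u y)) *\<^sub>m frame_x \<psi> u y \<nu>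
      - (2 * eu u y) *\<^sub>m (frame_x \<psi> u y \<nu> ** frame_x \<psi> u y \<nu> + (2 * \<beta> / 3) *\<^sub>m mat 1)
      - c_check \<psi> u y \<nu> *\<^sub>m frame_y \<psi> u y \<nu>
      + (2 / 3 * (4 * (eu u y)\<^sup>2 - eu u y * (du u y)\<^sup>2 - 4 * \<psi> * cnj \<psi> / eu u y)) *\<^sub>m mat 1"
proof -
  define h where "h = complex_of_real (exp (u y / 2))"
  have h: "h \<noteq> 0" "eu u y = h\<^sup>2"
    using exp_half_metric[of u y] by (simp_all add: h_def)
  have \<beta>': "\<beta> = (du u y)\<^sup>2 / 4 + 2 * h\<^sup>2 + \<psi> * cnj \<psi> / (h\<^sup>2)\<^sup>2"
  proof -
    have "(du u y)\<^sup>2 / 4 = \<beta> - 2 * h\<^sup>2 - \<psi> * cnj \<psi> / (h\<^sup>2)\<^sup>2"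
      unfolding \<beta> h(2) by simp
    from this[symmetric] show ?thesis
      by (simp only: diff_eq_eq add_ac)
  qed
  show ?thesis
    unfolding vec_eq_iff forall_3 matrix_matrix_mult_def sum_3 mat_scale_nth vec_lambda_beta
      vector_add_component vector_minus_component mat_def
      Q_generator_def frame_x_entries frame_y_entries vector_3 c_check_def h(2) \<beta>' h_def[symmetric]
    using \<nu> h(1)
    by (intro conjI; simp add: field_simps power2_eq_square power3_eq_cube power4_eq_xxxx)
qed

lemma potential_trace:
  assumes "\<nu> \<noteq> 0"
  shows "trace (potential a b \<nu> ** potential a b \<nu>) = - 2 * of_real (par_beta a b)"
proof -
  have "of_real (par_beta a b) = 2 * (a * cnj a) + b * cnj b"
    unfolding par_beta_def of_real_add of_real_mult complex_norm_square by simp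
  then show ?thesis
    using assms by (simp add: trace_def sum_3 matrix_matrix_mult_def potential_def field_simps)
qed

text \<open>With \<open>E = exp (- M)\<close> the product \<open>E G Q\<close> has derivative \<open>E G (P + B - (P + B)) Q = 0\<close>, where \<open>P\<close>
  is \<open>- M'\<close> with \<open>D\<close> replaced by \<open>A\<close>; it starts at the identity matrix.\<close>

lemma explicit_frame_on_imaginary_axis:
  fixes u :: "real \<Rightarrow> real" and F :: "complex \<Rightarrow> complex \<Rightarrow> cmat3"
  assumes a: "a = \<i> * of_real (exp (u 0 / 2))" and u'0: "deriv u 0 = 0"
    and ext: "extended_frame \<psi> u F" and spl: "iwasawa_splitting (potential a b) F Up"
    and first_integral: "\<And>y. (du u y)\<^sup>2 =
      4 * (of_real (par_beta a b) - 2 * eu u y - \<psi> * cnj \<psi> / (eu u y)\<^sup>2)"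
    and \<nu>: "\<nu> \<noteq> 0" and nz: "\<And>s. s \<in> closed_segment 0 y \<Longrightarrow> c_check \<psi> u s \<nu> \<noteq> 0"
  shows "mat_exp ((beta1 \<psi> u y \<nu> - \<i> * of_real y) *\<^sub>m potential a b \<nu>) **
    mat_exp (beta2 \<psi> u y \<nu> *\<^sub>m L0 (potential a b \<nu>)) ** (F (\<i> * of_real y) \<nu> ** Q_mat a \<psi> u y \<nu>) = mat 1"
proof -
  define S where "S = closed_segment 0 y"
  have S: "S = {min 0 y..max 0 y}"
    by (auto simp: S_def closed_segment_eq_real_ivl)
  define D where "D = potential a b \<nu>"
  define x where "x = \<nu>^3 * cnj \<psi>"
  define z where "z = \<psi> / \<nu>^3"
  define h where "h t = complex_of_real (exp (u t / 2))" for t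
  define U where "U = du u"
  define c where "c t = c_check \<psi> u t \<nu>" for t
  define n1 where "n1 t = 2 * \<i> * \<nu>^3 * cnj \<psi> - \<i> * du u t * eu u t" for t
  define n2 where "n2 t = 2 * eu u t" for t
  define c' where "c' t = 4 * (h t)^4 - (h t)\<^sup>2 * (U t)\<^sup>2 - 4 * \<psi> * cnj \<psi> / (h t)\<^sup>2" for t
  define \<beta> where "\<beta> = complex_of_real (par_beta a b)"
  define A where "A t = frame_x \<psi> u t \<nu>" for t
  define B where "B t = frame_y \<psi> u t \<nu>" for t
  define G where "G t = F (\<i> * of_real t) \<nu>" for t :: real
  define Q where "Q t = Q_mat a \<psi> u t \<nu>" for t
  define N where "N t = Q_num a \<nu> x z (h t) (U t)" for t
  define X where "X t = mat_exp ((beta1 \<psi> u t \<nu> - \<i> * of_real t) *\<^sub>m D)" for t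
  define Y where "Y t = mat_exp (beta2 \<psi> u t \<nu> *\<^sub>m L0 D)" for t
  have a': "a \<noteq> 0" "cnj a = - a"
    by (simp_all add: a)
  have xz: "x * z = \<psi> * cnj \<psi>"
    using \<nu> by (simp add: x_def z_def)
  have h: "h t \<noteq> 0" "eu u t = (h t)\<^sup>2" for t
    using exp_half_metric[of u t] by (simp_all add: h_def)
  have c: "c t = x - z - (h t)\<^sup>2 * U t" for t
    by (simp add: c_def c_check_def x_def z_def U_def h)
  have nz: "c t \<noteq> 0" if "t \<in> S" for t
    using nz that by (simp add: S_def c_def)
  have u: "(u has_real_derivative deriv u t) (at t within T)" for t T
  proof -
    have "u differentiable (at t)"
      using ext by (simp add: extended_frame_def)
    then show ?thesis
      using DERIV_deriv_iff_real_differentiable has_field_derivative_at_within by blast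
  qed
  have h': "(h has_vector_derivative U t / 2 * h t) (at t within S)" for t
  proof -
    have "((\<lambda>t. exp (u t / 2)) has_real_derivative deriv u t / 2 * exp (u t / 2)) (at t within S)"
      by (auto intro!: derivative_eq_intros u)
    then have "(h has_vector_derivative of_real (deriv u t / 2 * exp (u t / 2))) (at t within S)"
      unfolding h_def by (rule has_vector_derivative_of_real)
    then show ?thesis
      by (simp add: h_def U_def du_def)
  qed
  have hi': "((\<lambda>t. 1 / h t) has_vector_derivative - (U t / 2 / h t)) (at t within S)" for t
  proof -
    have "((\<lambda>t. exp (- u t / 2)) has_real_derivative - (deriv u t / 2) * exp (- u t / 2)) (at t within S)"
      by (auto intro!: derivative_eq_intros u)
    then have "((\<lambda>t. complex_of_real (exp (- u t / 2))) has_vector_derivative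
        of_real (- (deriv u t / 2) * exp (- u t / 2))) (at t within S)"
      by (rule has_vector_derivative_of_real)
    moreover have "complex_of_real (exp (- u t / 2)) = 1 / h t" for t
      unfolding h_def by (rule exp_half_metric(3))
    ultimately show ?thesis
      unfolding of_real_mult by (simp add: U_def du_def mult.commute)
  qed
  have U': "(U has_vector_derivative 4 * (x * z / (h t)^4 - (h t)\<^sup>2)) (at t within S)" for t
  proof -
    have \<psi>: "complex_of_real ((cmod \<psi>)\<^sup>2) = x * z"
      unfolding xz by (rule complex_norm_square)
    have e1: "complex_of_real (exp (u t)) = (h t)\<^sup>2"
      using h(2)[of t] by (simp add: eu_def)
    have e2: "complex_of_real (exp (- 2 * u t)) = 1 / (h t)^4"
    proof -
      have "exp (- 2 * u t) = 1 / (exp (u t / 2))^4"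
        using exp_minus[of "2 * u t"] by (simp add: inverse_eq_divide flip: exp_of_nat_mult)
      then show ?thesis
        by (simp add: h_def)
    qed
    have "(U has_vector_derivative of_real (4 * ((cmod \<psi>)\<^sup>2 * exp (- 2 * u t) - exp (u t)))) (at t within S)"
    proof -
      have "U = (\<lambda>t. complex_of_real (deriv u t))"
        by (simp add: U_def du_def fun_eq_iff)
      then show ?thesis
        using has_vector_derivative_of_real[OF has_field_derivative_at_within[OF metric_second_derivative[OF ext spl, of t]]]
        by simp
    qed
    also have "of_real (4 * ((cmod \<psi>)\<^sup>2 * exp (- 2 * u t) - exp (u t))) = 4 * (x * z / (h t)^4 - (h t)\<^sup>2)"
      by (simp only: of_real_mult of_real_diff of_real_numeral \<psi> e1 e2 times_divide_eq_right mult_1_right)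
    finally show ?thesis .
  qed
  have cd: "(c has_vector_derivative c' t) (at t within S)" for t
  proof -
    have "(c has_vector_derivative - ((h t * (U t / 2 * h t) + U t / 2 * h t * h t) * U t
        + h t * h t * (4 * (x * z / (h t)^4 - (h t)\<^sup>2)))) (at t within S)"
      unfolding c power2_eq_square
      by (rule has_vector_derivative_eq_rhs, (rule derivative_intros h' U'[unfolded power2_eq_square])+)
        (simp add: algebra_simps)
    also have "- ((h t * (U t / 2 * h t) + U t / 2 * h t * h t) * U t
        + h t * h t * (4 * (x * z / (h t)^4 - (h t)\<^sup>2))) = c' t"
      using h(1)[of t] xz
      by (simp add: c'_def field_simps power2_eq_square power4_eq_xxxx)
    finally show ?thesis .
  qed
  have cont: "continuous_on T h" "continuous_on T U" "continuous_on T c" if "T \<subseteq> S" for T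
    using h' U' cd that
    by (meson continuous_on_eq_continuous_within continuous_on_subset has_vector_derivative_continuous)+
  have cont_n: "continuous_on S n1" "continuous_on S n2" "continuous_on S c'"
    unfolding n1_def n2_def c'_def U_def[symmetric] h(2)
    using cont[OF order_refl] h(1) by (auto intro!: continuous_intros)
  have b1: "((\<lambda>t. beta1 \<psi> u t \<nu>) has_vector_derivative n1 t / c t) (at t within S)"
    and b2: "((\<lambda>t. beta2 \<psi> u t \<nu>) has_vector_derivative n2 t / c t) (at t within S)" if "t \<in> S" for t
    unfolding beta1_def beta2_def n1_def[symmetric] n2_def[symmetric] c_def[symmetric] S
    by (intro interval_integral_from_0_has_vector_derivative;
        use that cont[OF order_refl] cont_n nz in \<open>auto intro!: continuous_intros simp flip: S\<close>)+
  have du0: "du u 0 = 0"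
    by (simp add: du_def u'0)
  have \<kappa>: "((\<lambda>s. kappa \<psi> u s \<nu>) has_vector_derivative 2 / 3 * (c' t / c t) * kappa \<psi> u t \<nu>) (at t within S)"
    "kappa \<psi> u t \<nu> \<noteq> 0" "kappa \<psi> u 0 \<nu> = \<nu>^3 * c 0" if "t \<in> S" for t
    using kappa_has_vector_derivative[OF \<nu> du0, of t y \<psi> c'] that cd cont_n(3) nz
    unfolding S_def c_def by blast+
  \<comment> \<open>The derivative of \<open>- M\<close>, transported by \<open>D G = G A\<close>; the constant \<open>2 \<beta> / 3\<close> is minus a third of the trace of \<open>D\<^sup>2\<close>.\<close>
  define P where "P t = (n1 t / c t - \<i>) *\<^sub>m A t + (n2 t / c t) *\<^sub>m (A t ** A t + (2 * \<beta> / 3) *\<^sub>m mat 1)" for t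
  have Q_N: "Q t = (\<nu>^3 / kappa \<psi> u t \<nu>) *\<^sub>m N t" for t
    unfolding Q_def N_def x_def z_def h_def U_def by (rule Q_mat_eq_Q_num[OF a' \<nu>])
  have Q': "(Q has_vector_derivative - ((P t + B t) ** Q t)) (at t within S)" if t: "t \<in> S" for t
  proof -
    define \<rho> where "\<rho> t = \<nu>^3 / kappa \<psi> u t \<nu>" for t
    have Qgen: "Q_generator \<nu> x z (h t) (U t) = (2 / 3 * c' t) *\<^sub>m mat 1 - c t *\<^sub>m (P t + B t)"
    proof -
      have "4 * (eu u t)\<^sup>2 - eu u t * (du u t)\<^sup>2 - 4 * \<psi> * cnj \<psi> / eu u t = c' t"
        by (simp add: c'_def h U_def)
      then have "Q_generator \<nu> x z (h t) (U t) = (\<i> * c t - n1 t) *\<^sub>m A t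
          - n2 t *\<^sub>m (A t ** A t + (2 * \<beta> / 3) *\<^sub>m mat 1) - c t *\<^sub>m B t + (2 / 3 * c' t) *\<^sub>m mat 1"
        using Q_generator_eq_connection[OF \<nu> first_integral[of t]]
        unfolding x_def z_def h_def U_def c_def n1_def n2_def A_def B_def \<beta>_def by simp
      moreover have "c t *\<^sub>m P t = (n1 t - \<i> * c t) *\<^sub>m A t
          + n2 t *\<^sub>m (A t ** A t + (2 * \<beta> / 3) *\<^sub>m mat 1)"
        using nz[OF t] by (simp add: P_def mat_scale_algebra(3,7) right_diff_distrib mult.commute)
      ultimately show ?thesis
        by (simp add: mat_scale_algebra)
    qed
    have "(\<rho> has_vector_derivative - (2 / 3 * (c' t / c t)) * \<rho> t) (at t within S)"
    proof -
      have "((\<lambda>t. inverse (kappa \<psi> u t \<nu>)) has_vector_derivative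
          (2 / 3 * (c' t / c t) * kappa \<psi> u t \<nu>) * - (inverse (kappa \<psi> u t \<nu>) ^ Suc (Suc 0))) (at t within S)"
        using field_vector_diff_chain_within[OF \<kappa>(1)[OF t] DERIV_inverse[OF \<kappa>(2)[OF t], THEN has_field_derivative_at_within]]
        by (simp add: o_def)
      from has_vector_derivative_mult_right[OF this, of "\<nu>^3"]
      have "(\<rho> has_vector_derivative
          \<nu>^3 * ((2 / 3 * (c' t / c t) * kappa \<psi> u t \<nu>) * - (inverse (kappa \<psi> u t \<nu>) ^ Suc (Suc 0)))) (at t within S)"
        unfolding \<rho>_def divide_inverse[of "\<nu>^3"] .
      also have "\<nu>^3 * ((2 / 3 * (c' t / c t) * kappa \<psi> u t \<nu>) * - (inverse (kappa \<psi> u t \<nu>) ^ Suc (Suc 0)))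
          = - (2 / 3 * (c' t / c t)) * \<rho> t"
        using \<kappa>(2)[OF t] by (simp add: \<rho>_def field_simps)
      finally show ?thesis .
    qed
    moreover have "(N has_vector_derivative (1 / c t) *\<^sub>m (Q_generator \<nu> x z (h t) (U t) ** N t)) (at t within S)"
    proof -
      have "(N has_vector_derivative Q_num_deriv a \<nu> x z (h t) (U t) (4 * (x * z / (h t)^4 - (h t)\<^sup>2))) (at t within S)"
        unfolding N_def by (rule Q_num_has_vector_derivative[OF h' hi' U'])
      moreover have num: "c t *\<^sub>m Q_num_deriv a \<nu> x z (h t) (U t) (4 * (x * z / (h t)^4 - (h t)\<^sup>2)) =
          Q_generator \<nu> x z (h t) (U t) ** N t"
        unfolding c N_def by (rule Q_num_deriv_eq[OF a'(1) \<nu> h(1)])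
      ultimately show ?thesis
        unfolding num[symmetric] using nz[OF t] by (simp add: mat_scale_algebra)
    qed
    ultimately have "(Q has_vector_derivative \<rho> t *\<^sub>m ((1 / c t) *\<^sub>m (Q_generator \<nu> x z (h t) (U t) ** N t))
        + (- (2 / 3 * (c' t / c t)) * \<rho> t) *\<^sub>m N t) (at t within S)"
      unfolding Q_N \<rho>_def[symmetric] by (intro mat_scale_has_vector_derivative)
    also have "\<rho> t *\<^sub>m ((1 / c t) *\<^sub>m (Q_generator \<nu> x z (h t) (U t) ** N t))
        + (- (2 / 3 * (c' t / c t)) * \<rho> t) *\<^sub>m N t = - ((P t + B t) ** Q t)"
    proof -
      have "(1 / c t) *\<^sub>m (Q_generator \<nu> x z (h t) (U t) ** N t) = (2 / 3 * (c' t / c t)) *\<^sub>m N t - (P t + B t) ** N t"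
        unfolding Qgen using nz[OF t] by (simp add: matrix_mult_add(3) mat_scale_algebra(1,6,7,8) mult.commute)
      then show ?thesis
        unfolding Q_N \<rho>_def[symmetric] by (simp add: mat_scale_algebra mult_ac matrix_mult_add)
    qed
    finally show ?thesis .
  qed
  define E where "E t = X t ** Y t" for t
  have D_G: "D ** G t = G t ** A t" for t
    unfolding D_def G_def A_def by (rule frame_intertwines[OF ext spl \<nu>])
  have L0_G: "L0 D ** G t = G t ** (A t ** A t + (2 * \<beta> / 3) *\<^sub>m mat 1)" for t
  proof -
    have "L0 D = D ** D + (2 * \<beta> / 3) *\<^sub>m mat 1"
      unfolding L0_def D_def potential_trace[OF \<nu>] \<beta>_def by (simp add: mat_scale_algebra)
    moreover have "D ** D ** G t = G t ** (A t ** A t)"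
      by (metis D_G matrix_mul_assoc)
    ultimately show ?thesis
      by (simp add: matrix_mult_add mat_scale_algebra)
  qed
  have G': "(G has_vector_derivative G t ** B t) (at t within S)" for t
    unfolding G_def B_def by (rule frame_has_vector_derivative_y[OF ext \<nu>])
  have D_L0: "D ** L0 D = L0 D ** D"
    unfolding L0_def by (simp add: matrix_mult_add mat_scale_algebra matrix_mul_assoc)
  have D_X: "D ** X t = X t ** D" for t
    unfolding X_def by (rule mat_exp_commute) (simp add: mat_scale_algebra matrix_mult_add)
  have L_X: "L0 D ** X t = X t ** L0 D" for t
    unfolding X_def by (rule mat_exp_commute) (simp add: mat_scale_algebra matrix_mult_add D_L0)
  have D_Y: "D ** Y t = Y t ** D" for t
    unfolding Y_def by (rule mat_exp_commute) (simp add: mat_scale_algebra matrix_mult_add D_L0)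
  have L_Y: "L0 D ** Y t = Y t ** L0 D" for t
    unfolding Y_def by (rule mat_exp_commute) (simp add: mat_scale_algebra matrix_mult_add)
  have E': "(E has_vector_derivative E t ** ((n1 t / c t - \<i>) *\<^sub>m D + (n2 t / c t) *\<^sub>m L0 D)) (at t within S)"
    if t: "t \<in> S" for t
  proof -
    have "((\<lambda>t. beta1 \<psi> u t \<nu> - \<i> * of_real t) has_vector_derivative n1 t / c t - \<i> * 1) (at t within S)"
      by (intro has_vector_derivative_diff b1 t has_vector_derivative_mult_right) (auto intro!: derivative_eq_intros)
    then have "(E has_vector_derivative
        X t ** ((n2 t / c t) *\<^sub>m (L0 D ** Y t)) + ((n1 t / c t - \<i> * 1) *\<^sub>m (D ** X t)) ** Y t) (at t within S)"
      unfolding E_def X_def Y_def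
      by (intro has_vector_derivative_matrix_mult mat_exp_has_vector_derivative b2 t)
    moreover have "X t ** ((n2 t / c t) *\<^sub>m (L0 D ** Y t)) + ((n1 t / c t - \<i> * 1) *\<^sub>m (D ** X t)) ** Y t
        = E t ** ((n1 t / c t - \<i>) *\<^sub>m D + (n2 t / c t) *\<^sub>m L0 D)"
    proof -
      have "X t ** D ** Y t = X t ** Y t ** D" "X t ** (L0 D ** Y t) = X t ** Y t ** L0 D"
        by (metis D_Y matrix_mul_assoc, metis L_Y matrix_mul_assoc)
      then show ?thesis
        by (simp add: E_def matrix_mult_add mat_scale_algebra D_X add.commute)
    qed
    ultimately show ?thesis by simp
  qed
  have "((\<lambda>t. E t ** (G t ** Q t)) has_vector_derivative 0) (at t within S)" if t: "t \<in> S" for t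
  proof -
    let ?W = "(n1 t / c t - \<i>) *\<^sub>m D + (n2 t / c t) *\<^sub>m L0 D"
    have W: "?W ** G t = G t ** P t"
      by (simp add: P_def matrix_mult_add mat_scale_algebra D_G L0_G)
    have "((\<lambda>t. E t ** (G t ** Q t)) has_vector_derivative
        E t ** (G t ** (- ((P t + B t) ** Q t)) + (G t ** B t) ** Q t) + (E t ** ?W) ** (G t ** Q t)) (at t within S)"
      by (intro has_vector_derivative_matrix_mult E' G' Q' t)
    moreover have "(E t ** ?W) ** (G t ** Q t) = E t ** (G t ** (P t ** Q t))"
      by (metis W matrix_mul_assoc)
    moreover have "E t ** (G t ** (- ((P t + B t) ** Q t)) + (G t ** B t) ** Q t) + E t ** (G t ** (P t ** Q t)) = 0"
      by (simp add: matrix_mult_add matrix_mult_minus matrix_mul_assoc)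
    ultimately show ?thesis by simp
  qed
  then have "E y ** (G y ** Q y) = E 0 ** (G 0 ** Q 0)"
    by (rule matrix_constant_of_derivative_zero[of S, rotated]) (simp_all add: S_def)
  also have "\<dots> = mat 1"
  proof -
    have "E 0 = mat 1"
      by (simp add: E_def X_def Y_def beta1_def beta2_def mat_scale_algebra flip: zero_ereal_def)
    moreover have "G 0 = mat 1"
      using ext \<nu> by (simp add: G_def extended_frame_def)
    moreover have "Q 0 = mat 1"
    proof -
      have "0 \<in> S"
        by (simp add: S_def)
      \<comment> \<open>The choice of \<open>a\<close> makes \<open>Q_num\<close> a multiple of the identity at \<open>0\<close>, since \<open>a\<^sup>2 + h\<^sup>2 = 0\<close> there.\<close>
      have a0: "a = \<i> * h 0" "U 0 = 0"
        by (simp_all add: a h_def U_def du0)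
      then have "N 0 = (x - z) *\<^sub>m mat 1"
        using h(1)[of 0]
        by (simp add: N_def Q_num_def vec_eq_iff forall_3 mat_def field_simps power2_eq_square)
      then have "N 0 = c 0 *\<^sub>m mat 1"
        by (simp add: c a0)
      then show ?thesis
        using \<nu> nz[OF \<open>0 \<in> S\<close>] by (simp add: Q_N \<kappa>(3)[OF \<open>0 \<in> S\<close>] mat_scale_algebra)
    qed
    ultimately show ?thesis by simp
  qed
  finally show ?thesis
    by (simp add: E_def X_def Y_def G_def Q_def D_def)
qed

text \<open>The statement along the imaginary axis extends to all \<open>z\<close> by equivariance: \<open>exp (x D)\<close> commutes with
  \<open>exp M\<close>, and \<open>x D + M\<close> is the exponent in the theorem. In the proof \<open>K\<close> stands for \<open>- M\<close>.\<close>

theorem theorem5p6: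
  fixes a b \<psi> :: complex
    and u :: "real \<Rightarrow> real"
    and F :: "complex \<Rightarrow> complex \<Rightarrow> complex ^ 3 ^ 3"
    and Up :: "real \<Rightarrow> complex \<Rightarrow> complex ^ 3 ^ 3"
  assumes ab: "a * b \<noteq> 0"
    and a_eq: "a = \<i> * of_real (exp (u 0 / 2))"
    and psi_eq: "\<psi> = - \<i> * a\<^sup>2 * b"
    and u_crit: "(u has_real_derivative 0) (at 0)"
    and u_max: "\<forall>y. u y \<le> u 0"
    and a1_gt_a2: "par_a1 a > par_a2 a b"
    and frame: "extended_frame \<psi> u F"
    and splitting: "iwasawa_splitting (potential a b) F Up"
  shows "(\<forall>y. exp (u y) =
              par_a1 a * (1 - (par_q a b)\<^sup>2 * (jacobi_sn (par_r a b * y) (par_k a b))\<^sup>2)) \<and>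
         (\<forall>z \<nu>. \<nu> \<noteq> 0 \<and> (\<forall>s\<in>closed_segment 0 (Im z). c_check \<psi> u s \<nu> \<noteq> 0) \<longrightarrow>
            invertible (Q_mat a \<psi> u (Im z) \<nu>) \<and>
            F z \<nu> =
              mat_exp (z *\<^sub>m potential a b \<nu>
                       - beta1 \<psi> u (Im z) \<nu> *\<^sub>m potential a b \<nu>
                       - beta2 \<psi> u (Im z) \<nu> *\<^sub>m L0 (potential a b \<nu>))
              ** matrix_inv (Q_mat a \<psi> u (Im z) \<nu>))"
proof -
  define m where "m = (cmod \<psi>)\<^sup>2"
  note par = elliptic_parameters[OF ab]
  have u: "(u has_real_derivative deriv u y) (at y)" for y
    using frame by (simp add: extended_frame_def DERIV_deriv_iff_real_differentiable)
  have u': "(deriv u has_real_derivative 4 * (m * exp (- 2 * u y) - exp (u y))) (at y)" for y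
    unfolding m_def by (rule metric_second_derivative[OF frame splitting])
  have u'0: "deriv u 0 = 0"
    using u_crit by (rule DERIV_imp_deriv)
  have a1: "par_a1 a = exp (u 0)"
    by (simp add: par_a1_def a_eq norm_mult power2_eq_square flip: exp_add)
  have \<beta>: "par_beta a b = 2 * exp (u 0) + m * exp (- 2 * u 0)"
  proof -
    have "cmod \<psi> = exp (u 0) * cmod b"
      using a1 by (simp add: psi_eq norm_mult norm_power par_a1_def)
    then have "m * exp (- 2 * u 0) = (cmod b)\<^sup>2 * (exp (u 0) * exp (u 0) * exp (- 2 * u 0))"
      by (simp add: m_def power2_eq_square)
    also have "exp (u 0) * exp (u 0) * exp (- 2 * u 0) = 1"
      by (simp flip: exp_add)
    finally show ?thesis
      using a1 by (simp add: par_beta_def par_a1_def)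
  qed
  have energy: "(deriv u y)\<^sup>2 = 4 * (par_beta a b - 2 * exp (u y) - m * exp (- 2 * u y))" for y
    by (rule metric_first_integral[OF u u' u'0 \<beta>])
  have metric: "exp (u y) = par_a1 a * (1 - (par_q a b)\<^sup>2 * (jacobi_sn (par_r a b * y) (par_k a b))\<^sup>2)" for y
  proof -
    have w: "((\<lambda>y. exp (u y)) has_real_derivative deriv u y * exp (u y)) (at y)" for y
      by (auto intro!: derivative_eq_intros u)
    have w': "((\<lambda>y. deriv u y * exp (u y)) has_real_derivative
        4 * par_beta a b * exp (u y) - 12 * (exp (u y))\<^sup>2) (at y)" for y
    proof -
      have "((\<lambda>y. deriv u y * exp (u y)) has_real_derivative
          4 * (m * exp (- 2 * u y) - exp (u y)) * exp (u y) + deriv u y * exp (u y) * deriv u y) (at y)"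
        by (rule DERIV_mult[OF u' w])
      also have "4 * (m * exp (- 2 * u y) - exp (u y)) * exp (u y) + deriv u y * exp (u y) * deriv u y
          = (4 * (m * exp (- 2 * u y) - exp (u y)) + (deriv u y)\<^sup>2) * exp (u y)"
        by (simp add: power2_eq_square algebra_simps)
      also have "\<dots> = 4 * par_beta a b * exp (u y) - 12 * (exp (u y))\<^sup>2"
        unfolding energy by (simp add: power2_eq_square algebra_simps)
      finally show ?thesis .
    qed
    have "exp (u y) = par_a1 a - (par_a1 a - par_a2 a b) * (jacobi_sn (par_r a b * y) (par_k a b))\<^sup>2"
    proof (rule metric_explicit[OF par(1,2,3) a1_gt_a2 par(4,5) _ _ w w'])
      show "(par_k a b)\<^sup>2 = (par_a1 a - par_a2 a b) / (par_a1 a + par_a3 a b)"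
        "(par_r a b)\<^sup>2 = 2 * (par_a1 a + par_a3 a b)"
        using par a1_gt_a2 by (simp_all add: par_k_def par_r_def)
    qed (use u_max u'0 in \<open>simp_all add: a1\<close>)
    moreover have "par_a1 a * (par_q a b)\<^sup>2 = par_a1 a - par_a2 a b"
      using par a1_gt_a2 by (simp add: par_q_def)
    ultimately show ?thesis
      by (simp add: right_diff_distrib flip: mult.assoc)
  qed
  have energy_complex: "(du u y)\<^sup>2 = 4 * (of_real (par_beta a b) - 2 * eu u y - \<psi> * cnj \<psi> / (eu u y)\<^sup>2)" for y
  proof -
    have "exp (- 2 * u y) = 1 / (exp (u y))\<^sup>2"
      using exp_minus[of "2 * u y"] by (simp add: inverse_eq_divide exp_double)
    then have "(du u y)\<^sup>2 = of_real (4 * (par_beta a b - 2 * exp (u y) - m * (1 / (exp (u y))\<^sup>2)))"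
      using energy[of y] by (simp only: du_def flip: of_real_power)
    moreover have "complex_of_real m = \<psi> * cnj \<psi>"
      unfolding m_def by (rule complex_norm_square)
    ultimately show ?thesis
      by (simp add: eu_def)
  qed
  have "invertible (Q_mat a \<psi> u (Im z) \<nu>) \<and>
      F z \<nu> = mat_exp (z *\<^sub>m potential a b \<nu> - beta1 \<psi> u (Im z) \<nu> *\<^sub>m potential a b \<nu>
          - beta2 \<psi> u (Im z) \<nu> *\<^sub>m L0 (potential a b \<nu>)) ** matrix_inv (Q_mat a \<psi> u (Im z) \<nu>)"
    if \<nu>: "\<nu> \<noteq> 0" and nz: "\<forall>s\<in>closed_segment 0 (Im z). c_check \<psi> u s \<nu> \<noteq> 0" for z \<nu>
  proof -
    define y where "y = Im z"
    define D where "D = potential a b \<nu>"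
    define L where "L = L0 D"
    define \<beta>1 where "\<beta>1 = beta1 \<psi> u y \<nu>"
    define \<beta>2 where "\<beta>2 = beta2 \<psi> u y \<nu>"
    define K where "K = (\<beta>1 - \<i> * of_real y) *\<^sub>m D + \<beta>2 *\<^sub>m L"
    define G where "G = F (\<i> * of_real y) \<nu>"
    define Q where "Q = Q_mat a \<psi> u y \<nu>"
    have DL: "D ** L = L ** D"
      unfolding L_def L0_def by (simp add: matrix_mult_add mat_scale_algebra matrix_mul_assoc)
    have "mat_exp K = mat_exp ((\<beta>1 - \<i> * of_real y) *\<^sub>m D) ** mat_exp (\<beta>2 *\<^sub>m L)"
      unfolding K_def by (rule mat_exp_add) (simp add: mat_scale_algebra(1,2,7) DL mult.commute)
    then have 1: "mat_exp K ** (G ** Q) = mat 1"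
      using explicit_frame_on_imaginary_axis[OF a_eq u'0 frame splitting energy_complex \<nu>, of y] nz
      by (simp add: y_def D_def L_def \<beta>1_def \<beta>2_def G_def Q_def)
    then have inv: "invertible Q"
      unfolding invertible_left_inverse matrix_mul_assoc by blast
    have "G ** Q = mat_exp (- K) ** (mat_exp K ** (G ** Q))"
      by (simp add: matrix_mul_assoc mat_exp_minus_mult)
    then have "G ** Q = mat_exp (- K)"
      by (simp add: 1)
    then have G: "G = mat_exp (- K) ** matrix_inv Q"
      by (metis inv matrix_inv_cancel(1) matrix_mul_assoc matrix_mul_rid)
    have "F z \<nu> = mat_exp (of_real (Re z) *\<^sub>m D) ** G"
      using frame_equivariant[OF frame splitting \<nu>, of "Re z" y] complex_eq[of z]
      by (simp add: y_def D_def G_def)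
    also have "\<dots> = mat_exp (of_real (Re z) *\<^sub>m D) ** mat_exp (- K) ** matrix_inv Q"
      by (simp add: G matrix_mul_assoc)
    also have "mat_exp (of_real (Re z) *\<^sub>m D) ** mat_exp (- K) = mat_exp (of_real (Re z) *\<^sub>m D + (- K))"
      by (rule mat_exp_add[symmetric])
        (simp add: K_def mat_scale_algebra matrix_mult_add matrix_mult_minus DL mult.commute)
    also have "of_real (Re z) *\<^sub>m D + (- K) = z *\<^sub>m D - \<beta>1 *\<^sub>m D - \<beta>2 *\<^sub>m L"
    proof -
      have "z *\<^sub>m D = of_real (Re z) *\<^sub>m D + (\<i> * of_real y) *\<^sub>m D"
        unfolding y_def by (simp flip: mat_scale_algebra(4) complex_eq)
      then show ?thesis
        by (simp add: K_def mat_scale_algebra(5))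
    qed
    finally show ?thesis
      using inv by (simp add: y_def D_def L_def \<beta>1_def \<beta>2_def Q_def)
  qed
  with metric show ?thesis
    by blast
qed

end
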